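(* Let $D$ be a $t$-treed integral domain. The following statements are equivalent. (1) $D$ is a VFD. (2) $D$ is an HoFD and a P$v$MD. (3) $D$ is an independent ring of Krull type and ${\rm Cl}_t(D)=\{0\}$. (4) The polynomial ring $D[X]$ is a VFD. (5) $D$ is a weakly Matlis GCD-domain.
   Context: Let $D$ be an integral domain with quotient field $K$. For a nonzero fractional ideal $A$ let $A^{-1}=\{x\in K\mid xA\subseteq D\}$, $A_v=(A^{-1})^{-1}$ and $A_t=\bigcup\{I_v\mid I\subseteq A,\ I$ a nonzero finitely generated fractional ideal$\}$. $A$ is a $t$-ideal if $A_t=A$. A maximal $t$-ideal is a $t$-ideal maximal among proper integral $t$-ideals; a prime $t$-ideal is a (nonzero) prime ideal that is a $t$-ideal. $A$ is $t$-invertible if $(AA^{-1})_t=D$. The $t$-invertible fractional $t$-ideals form an abelian group ${\rm T}(D)$ under $I*J=(IJ)_t$; ${\rm Cl}_t(D)$ is the quotient of ${\rm T}(D)$ by the subgroup of nonzero principal fractional ideals. $D$ is $t$-treed if the set of prime $t$-ideals of $D$ is treed under inclusion (any two prime $t$-ideals contained in a common prime $t$-ideal are comparable). An overring of $D$ is a subring of $K$ containing $D$. A nonzero nonunit $a\in D$ is a valuation element if there is a valuation domain $V$ that is an overring of $D$ with $aV\cap D=aD$. $D$ is a VFD (valuation factorization domain) if every nonzero nonunit of $D$ is a finite product of valuation elements (and similarly for $D[X]$). A nonzero nonunit $x\in D$ is homogeneous if it is contained in a unique maximal $t$-ideal of $D$. $D$ is an HoFD (homogeneous factorization domain) if every nonzero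 nonunit is a finite product of homogeneous elements. $D$ is a P$v$MD (Prüfer $v$-multiplication domain) if every nonzero finitely generated ideal of $D$ is $t$-invertible. $D$ is of finite $t$-character if each nonzero nonunit lies in only finitely many maximal $t$-ideals. $D$ is a weakly Matlis domain if $D$ is of finite $t$-character and no two distinct maximal $t$-ideals of $D$ contain a common nonzero prime ideal. An independent ring of Krull type is a P$v$MD that is a weakly Matlis domain. A weakly Matlis GCD-domain is a GCD-domain that is a weakly Matlis domain. *)

theory Defs
  imports
    "HOL-Computational_Algebra.Polynomial_Factorial"
    "HOL-Algebra.Coset"
begin

(* The integral domain D is the carrier of a type 'a::idom, and K is 'a fract.
   All ideals, fractional or integral, are subsets of K; the ring D itself is
   identified with its image in K. *)

definition base_ring :: "'a::idom fract set" where
  "base_ring = range to_fract"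

definition fract_scale :: "'a::idom \<Rightarrow> 'a fract \<Rightarrow> 'a fract" where
  "fract_scale r x = to_fract r * x"

(* dsub.subspace: D-submodules of K; dsub.span: the D-submodule of K generated by a set. *)
global_interpretation dsub: module "fract_scale :: 'a::idom \<Rightarrow> 'a fract \<Rightarrow> 'a fract"
  by standard (simp_all add: fract_scale_def algebra_simps)

definition fractional_ideal :: "'a::idom fract set \<Rightarrow> bool" where
  "fractional_ideal A \<longleftrightarrow>
     dsub.subspace A \<and> (\<exists>d::'a. d \<noteq> 0 \<and> (\<forall>x\<in>A. to_fract d * x \<in> base_ring))"

definition nz_fractional_ideal :: "'a::idom fract set \<Rightarrow> bool" where
  "nz_fractional_ideal A \<longleftrightarrow> fractional_ideal A \<and> A \<noteq> {0}"

(* A finitely generated D-submodule of K is automatically a fractional ideal. *)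
definition fin_gen :: "'a::idom fract set \<Rightarrow> bool" where
  "fin_gen A \<longleftrightarrow> (\<exists>S. finite S \<and> A = dsub.span S)"

definition ideal_prod :: "'a::idom fract set \<Rightarrow> 'a fract set \<Rightarrow> 'a fract set" where
  "ideal_prod A B = dsub.span {a * b | a b. a \<in> A \<and> b \<in> B}"

definition principal :: "'a::idom fract \<Rightarrow> 'a fract set" where
  "principal x = dsub.span {x}"

definition ideal_inv :: "'a::idom fract set \<Rightarrow> 'a fract set" where
  "ideal_inv A = {x. \<forall>a\<in>A. x * a \<in> base_ring}"

definition v_closure :: "'a::idom fract set \<Rightarrow> 'a fract set" where
  "v_closure A = ideal_inv (ideal_inv A)"

definition t_closure :: "'a::idom fract set \<Rightarrow> 'a fract set" where
  "t_closure A = \<Union> {v_closure I | I. I \<subseteq> A \<and> nz_fractional_ideal I \<and> fin_gen I}"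

definition t_ideal :: "'a::idom fract set \<Rightarrow> bool" where
  "t_ideal A \<longleftrightarrow> nz_fractional_ideal A \<and> t_closure A = A"

definition t_invertible :: "'a::idom fract set \<Rightarrow> bool" where
  "t_invertible A \<longleftrightarrow>
     nz_fractional_ideal A \<and> t_closure (ideal_prod A (ideal_inv A)) = base_ring"

definition maximal_t_ideal :: "'a::idom fract set \<Rightarrow> bool" where
  "maximal_t_ideal M \<longleftrightarrow> t_ideal M \<and> M \<subset> base_ring \<and>
     (\<forall>N. t_ideal N \<and> N \<subset> base_ring \<and> M \<subseteq> N \<longrightarrow> N = M)"

definition prime_ideal :: "'a::idom fract set \<Rightarrow> bool" where
  "prime_ideal P \<longleftrightarrow> dsub.subspace P \<and> P \<subset> base_ring \<and>
     (\<forall>a\<in>base_ring. \<forall>b\<in>base_ring. a * b \<in> P \<longrightarrow> a \<in> P \<or> b \<in> P)"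

(* t_ideal already excludes the zero ideal. *)
definition prime_t_ideal :: "'a::idom fract set \<Rightarrow> bool" where
  "prime_t_ideal P \<longleftrightarrow> prime_ideal P \<and> t_ideal P"

definition t_treed :: "'a::idom itself \<Rightarrow> bool" where
  "t_treed _ \<longleftrightarrow>
     (\<forall>P Q M :: 'a fract set. prime_t_ideal P \<and> prime_t_ideal Q \<and> prime_t_ideal M \<and>
        P \<subseteq> M \<and> Q \<subseteq> M \<longrightarrow> P \<subseteq> Q \<or> Q \<subseteq> P)"

definition t_invertible_group :: "'a::idom fract set monoid" where
  "t_invertible_group =
     \<lparr>carrier = {A. t_ideal A \<and> t_invertible A},
      monoid.mult = (\<lambda>I J. t_closure (ideal_prod I J)),
      one = base_ring\<rparr>"

definition principal_ideals :: "'a::idom fract set set" where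
  "principal_ideals = {principal x | x. x \<noteq> 0}"

definition t_class_group :: "'a::idom fract set set monoid" where
  "t_class_group = t_invertible_group Mod principal_ideals"

definition trivial_t_class_group :: "'a::idom itself \<Rightarrow> bool" where
  "trivial_t_class_group _ \<longleftrightarrow>
     carrier (t_class_group :: 'a fract set set monoid) = {\<one>\<^bsub>t_class_group\<^esub>}"

definition nz_nonunit :: "'a::idom \<Rightarrow> bool" where
  "nz_nonunit a \<longleftrightarrow> a \<noteq> 0 \<and> \<not> a dvd 1"

definition overring :: "'a::idom fract set \<Rightarrow> bool" where
  "overring V \<longleftrightarrow> base_ring \<subseteq> V \<and>
     (\<forall>x\<in>V. \<forall>y\<in>V. x - y \<in> V) \<and> (\<forall>x\<in>V. \<forall>y\<in>V. x * y \<in> V)"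

(* The quotient field of any overring is K, so the usual condition
   "x or its inverse lies in V" is imposed on all nonzero elements of K. *)
definition valuation_overring :: "'a::idom fract set \<Rightarrow> bool" where
  "valuation_overring V \<longleftrightarrow> overring V \<and> (\<forall>x. x \<noteq> 0 \<longrightarrow> x \<in> V \<or> inverse x \<in> V)"

definition valuation_element :: "'a::idom \<Rightarrow> bool" where
  "valuation_element a \<longleftrightarrow> nz_nonunit a \<and>
     (\<exists>V. valuation_overring V \<and>
        ((*) (to_fract a) ` V) \<inter> base_ring = (*) (to_fract a) ` base_ring)"

definition vfd :: "'a::idom itself \<Rightarrow> bool" where
  "vfd _ \<longleftrightarrow> (\<forall>a::'a. nz_nonunit a \<longrightarrow>
     (\<exists>xs. (\<forall>x\<in>set xs. valuation_element x) \<and> a = prod_list xs))"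

definition homogeneous :: "'a::idom \<Rightarrow> bool" where
  "homogeneous x \<longleftrightarrow> nz_nonunit x \<and> (\<exists>!M. maximal_t_ideal M \<and> to_fract x \<in> M)"

definition hofd :: "'a::idom itself \<Rightarrow> bool" where
  "hofd _ \<longleftrightarrow> (\<forall>a::'a. nz_nonunit a \<longrightarrow>
     (\<exists>xs. (\<forall>x\<in>set xs. homogeneous x) \<and> a = prod_list xs))"

definition pvmd :: "'a::idom itself \<Rightarrow> bool" where
  "pvmd _ \<longleftrightarrow>
     (\<forall>I :: 'a fract set. fin_gen I \<and> I \<subseteq> base_ring \<and> I \<noteq> {0} \<longrightarrow> t_invertible I)"

definition finite_t_character :: "'a::idom itself \<Rightarrow> bool" where
  "finite_t_character _ \<longleftrightarrow>
     (\<forall>x::'a. nz_nonunit x \<longrightarrow> finite {M. maximal_t_ideal M \<and> to_fract x \<in> M})"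

definition weakly_matlis :: "'a::idom itself \<Rightarrow> bool" where
  "weakly_matlis (T :: 'a itself) \<longleftrightarrow> finite_t_character T \<and>
     (\<forall>M N :: 'a fract set. maximal_t_ideal M \<and> maximal_t_ideal N \<and> M \<noteq> N \<longrightarrow>
        \<not> (\<exists>P. prime_ideal P \<and> P \<noteq> {0} \<and> P \<subseteq> M \<and> P \<subseteq> N))"

definition independent_ring_of_Krull_type :: "'a::idom itself \<Rightarrow> bool" where
  "independent_ring_of_Krull_type T \<longleftrightarrow> pvmd T \<and> weakly_matlis T"

definition gcd_domain :: "'a::idom itself \<Rightarrow> bool" where
  "gcd_domain _ \<longleftrightarrow>
     (\<forall>a b :: 'a. \<exists>g. g dvd a \<and> g dvd b \<and> (\<forall>c. c dvd a \<and> c dvd b \<longrightarrow> c dvd g))"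

definition weakly_matlis_gcd_domain :: "'a::idom itself \<Rightarrow> bool" where
  "weakly_matlis_gcd_domain T \<longleftrightarrow> gcd_domain T \<and> weakly_matlis T"

end

theory Submission
  imports Defs
begin

text \<open>The proof reduces every condition to divisibility: each one says that \<open>D\<close> is a GCD domain in which
  every nonzero nonunit is a product of homogeneous elements.

  The bridge between ideals and divisibility is the relation \<open>(x, y)\<^sub>v = D\<close>, which for \<open>x \<noteq> 0\<close> is
  equivalent to the rule that \<open>x | yz\<close> implies \<open>x | z\<close> for all \<open>z\<close>, and to the absence of a maximal
  \<open>t\<close>-ideal containing both elements (\<open>v_coprime_iff_no_common_maximal_t_ideal\<close>). If the ring is generated
  multiplicatively by a divisor-closed set in which any two elements are either comparable or
  v-coprime, then greatest common divisors exist (\<open>gcd_domain_if_generated\<close>). So it suffices to show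
  that two generators in a common maximal \<open>t\<close>-ideal \<open>M\<close> are comparable.

  \<^item> For valuation elements \<open>x\<close> and \<open>y\<close>, the radicals of \<open>xD\<close> and \<open>yD\<close> are prime \<open>t\<close>-ideals below
    \<open>M\<close>. As \<open>D\<close> is \<open>t\<close>-treed, one of them contains the other, so \<open>y\<close> divides a power of \<open>x\<close>, say. All
    divisors of this power are comparable by their values. The same idea shows that a valuation
    element of a \<open>t\<close>-treed VFD is homogeneous.

  \<^item> For homogeneous elements of a P\<open>v\<close>MD, comparability comes from \<open>t\<close>-invertibility of \<open>(x, y)\<close>
    (\<open>homogeneous_comparable_in_pvmd\<close>).

  Conversely, in a GCD domain the divisors of a homogeneous element form a chain, and an element with
  this property is a valuation element for the ring of fractions whose denominators are coprime to it
  (\<open>rigid_imp_valuation_element\<close>). An HoFD is weakly Matlis because each nonzero prime ideal contains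
  a homogeneous element; for the converse in a GCD domain, independence of two maximal \<open>t\<close>-ideals
  allows a nonunit to be split into factors lying in fewer of them
  (\<open>weakly_matlis_gcd_imp_hofd\<close>). A \<open>t\<close>-invertible \<open>t\<close>-ideal is the \<open>v\<close>-closure of a finitely generated
  ideal, which in a GCD domain is generated by a greatest common divisor; this settles the class
  group.

  For the polynomial ring, the GCD property passes to \<open>D[X]\<close> by Gauss's lemma, and the chain condition
  on divisors makes it easy to factor: constants have only constant divisors, and irreducible
  polynomials satisfy it trivially. In the other direction valuation overrings of \<open>D[X]\<close> contract
  to \<open>D\<close>.\<close>

section \<open>Divisibility in GCD domains\<close>

definition gcd_of :: "'a::idom \<Rightarrow> 'a set \<Rightarrow> bool" where
  "gcd_of g S \<longleftrightarrow> (\<forall>c. c dvd g \<longleftrightarrow> (\<forall>s\<in>S. c dvd s))"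

text \<open>For \<open>x \<noteq> 0\<close> this says \<open>(x, y)\<^sub>v = D\<close>, phrased through divisibility alone. In a GCD domain it is
  coprimality, but over every domain it is multiplicative in \<open>y\<close> and symmetric in nonzero arguments.\<close>

definition v_coprime :: "'a::idom \<Rightarrow> 'a \<Rightarrow> bool" where
  "v_coprime x y \<longleftrightarrow> (\<forall>z. x dvd y * z \<longrightarrow> x dvd z)"

definition rigid :: "'a::idom \<Rightarrow> bool" where
  "rigid a \<longleftrightarrow> nz_nonunit a \<and> (\<forall>b c. b dvd a \<and> c dvd a \<longrightarrow> b dvd c \<or> c dvd b)"

lemma gcd_of_pair:
  "gcd_of g {a, b} \<longleftrightarrow> g dvd a \<and> g dvd b \<and> (\<forall>c. c dvd a \<and> c dvd b \<longrightarrow> c dvd g)"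
  unfolding gcd_of_def by (auto intro: dvd_trans)

lemma gcd_domain_iff: "gcd_domain TYPE('a::idom) \<longleftrightarrow> (\<forall>a b::'a. \<exists>g. gcd_of g {a, b})"
  by (simp add: gcd_domain_def gcd_of_pair)

lemma gcd_of_dvd: "gcd_of g S \<Longrightarrow> s \<in> S \<Longrightarrow> g dvd s"
  by (auto simp: gcd_of_def)

lemma gcd_of_finite_exists:
  assumes G: "gcd_domain TYPE('a::idom)" and "finite S"
  shows "\<exists>g::'a. gcd_of g S"
  using \<open>finite S\<close>
proof (induction S)
  case empty
  have "gcd_of (0::'a) {}" by (simp add: gcd_of_def)
  then show ?case ..
next
  case (insert x S)
  then obtain h where h: "gcd_of h S" by blast
  obtain g where "gcd_of g {x, h}" using G by (auto simp: gcd_domain_iff)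
  then have "gcd_of g (insert x S)" using h by (simp add: gcd_of_def)
  then show ?case ..
qed

lemma gcd_of_scale:
  assumes G: "gcd_domain TYPE('a::idom)" and S: "finite S" and g: "gcd_of (g::'a) S"
  shows "gcd_of (k * g) ((*) k ` S)"
proof (cases "k = 0")
  case True
  then show ?thesis using S g by (cases "S = {}") (auto simp: gcd_of_def)
next
  case False
  obtain h where h: "gcd_of h ((*) k ` S)"
    using gcd_of_finite_exists[OF G] S by blast
  have "k dvd h" using h by (auto simp: gcd_of_def)
  then obtain h' where h': "h = k * h'" ..
  have "h' dvd s" if "s \<in> S" for s
    using gcd_of_dvd[OF h, of "k * s"] that False h' by auto
  then have "h' dvd g" using g by (auto simp: gcd_of_def)
  then have "h dvd k * g" using h' by simp
  moreover have "k * g dvd h"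
  proof -
    have "\<forall>s\<in>(*) k ` S. k * g dvd s" using gcd_of_dvd[OF g] by (simp add: mult_dvd_mono)
    then show ?thesis using h by (simp add: gcd_of_def)
  qed
  ultimately have "c dvd k * g \<longleftrightarrow> c dvd h" for c by (meson dvd_trans)
  then show ?thesis using h by (simp add: gcd_of_def)
qed

lemma v_coprime_mult_right: "v_coprime a b \<Longrightarrow> v_coprime a c \<Longrightarrow> v_coprime a (b * c)"
  unfolding v_coprime_def by (metis mult.assoc)

lemma v_coprime_sym:
  assumes "v_coprime a b" "(a::'a::idom) \<noteq> 0"
  shows "v_coprime b a"
  unfolding v_coprime_def
proof (intro allI impI)
  fix z assume "b dvd a * z"
  then obtain w where w: "a * z = b * w" ..
  then have "a dvd b * w" by (metis dvd_triv_left)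
  then obtain w' where "w = a * w'" using assms unfolding v_coprime_def by blast
  then have "a * z = a * (b * w')" using w by (simp add: mult.left_commute)
  then show "b dvd z" using assms(2) by simp
qed

lemma v_coprime_common_divisor:
  assumes "v_coprime a b" "(a::'a::idom) \<noteq> 0" "c dvd a" "c dvd b"
  shows "c dvd 1"
proof -
  obtain s t where s: "a = c * s" and t: "b = c * t" using assms(3,4) by (elim dvdE)
  have "a dvd b * s" using s t by (metis dvd_triv_left mult.assoc mult.commute)
  then have "a dvd s" using assms(1) unfolding v_coprime_def by blast
  then have "c * s dvd 1 * s" using s by simp
  moreover have "s \<noteq> 0" using assms(2) s by auto
  ultimately show ?thesis by (metis dvd_mult_cancel_right)
qed

lemma gcd_one_imp_v_coprime:
  assumes G: "gcd_domain TYPE('a::idom)" and "gcd_of (1::'a) {a, b}"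
  shows "v_coprime a b"
  unfolding v_coprime_def
proof (intro allI impI)
  fix z assume z: "a dvd b * z"
  have "gcd_of (z * 1) ((*) z ` {a, b})" using gcd_of_scale[OF G _ assms(2)] by simp
  then show "a dvd z" using z by (auto simp: gcd_of_def mult.commute)
qed

lemma gcd_cofactors:
  assumes G: "gcd_domain TYPE('a::idom)" and "(a::'a) \<noteq> 0"
  obtains g a' b' where "a = g * a'" "b = g * b'" "v_coprime a' b'" "gcd_of g {a, b}"
proof -
  obtain g where g: "gcd_of g {a, b}" using G by (auto simp: gcd_domain_iff)
  then have "g dvd a" "g dvd b" by (auto simp: gcd_of_pair)
  then obtain a' b' where ab: "a = g * a'" "b = g * b'" by (elim dvdE)
  have "g \<noteq> 0" using assms(2) ab by auto
  have "c dvd 1" if "c dvd a'" "c dvd b'" for c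
  proof -
    have "g * c dvd g * 1" using g that ab by (simp add: gcd_of_pair)
    then show ?thesis using \<open>g \<noteq> 0\<close> by (metis dvd_mult_cancel_left)
  qed
  then have "gcd_of 1 {a', b'}" by (simp add: gcd_of_pair)
  from that[OF ab gcd_one_imp_v_coprime[OF G this] g] show thesis .
qed

lemma gcd_domain_primal:
  assumes G: "gcd_domain TYPE('a::idom)" and "(a::'a) \<noteq> 0" and "a dvd s * t"
  obtains a1 a2 where "a = a1 * a2" "a1 dvd s" "a2 dvd t"
proof -
  obtain g a' s' where *: "a = g * a'" "s = g * s'" "v_coprime a' s'"
    using gcd_cofactors[OF G assms(2)] by metis
  have "g * a' dvd g * (s' * t)" using assms(3) * by (simp add: mult.assoc)
  moreover have "g \<noteq> 0" using * assms(2) by auto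
  ultimately have "a' dvd s' * t" by simp
  then have "a' dvd t" using *(3) unfolding v_coprime_def by blast
  then show thesis using that * by simp
qed

text \<open>Two products of elements of \<open>H\<close> are compared factor by factor: as long as a factor of one
  divides a factor of the other, split off the common part, which shortens the two lists taken
  together; once no such pair is left, all pairs are v-coprime, and so are the two products. The parts
  split off multiply to a greatest common divisor.\<close>

lemma gcd_domain_if_generated:
  fixes H :: "'a::idom set"
  assumes factor: "\<And>a. a \<noteq> 0 \<Longrightarrow> \<exists>xs. set xs \<subseteq> H \<and> a = prod_list xs"
    and closed: "\<And>x y. x \<in> H \<Longrightarrow> y dvd x \<Longrightarrow> y \<in> H"
    and nz: "0 \<notin> H"
    and alt: "\<And>x y. x \<in> H \<Longrightarrow> y \<in> H \<Longrightarrow> x dvd y \<or> y dvd x \<or> v_coprime x y"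
  shows "gcd_domain TYPE('a)"
proof -
  have split: "\<exists>g a b. prod_list xs = g * a \<and> prod_list ys = g * b \<and> v_coprime a b"
    if "set xs \<subseteq> H" "set ys \<subseteq> H" for xs ys
    using that
  proof (induction "length xs + length ys" arbitrary: xs ys rule: less_induct)
    case less
    have step: "\<exists>g a b. prod_list us = g * a \<and> prod_list vs = g * b \<and> v_coprime a b"
      if uv: "set us \<subseteq> H" "set vs \<subseteq> H" "length us + length vs = length xs + length ys"
        and x: "x \<in> set us" and y: "y \<in> set vs" and "x dvd y" for us vs x y
    proof -
      obtain u where u: "y = x * u" using \<open>x dvd y\<close> ..
      obtain us1 us2 where us: "us = us1 @ x # us2" using x by (meson split_list)
      obtain vs1 vs2 where vs: "vs = vs1 @ y # vs2" using y by (meson split_list)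
      have "y \<in> H" using y uv by blast
      then have "u \<in> H" using closed u by (metis dvd_triv_right)
      then have "\<exists>g a b. prod_list (us1 @ us2) = g * a \<and> prod_list (u # vs1 @ vs2) = g * b
          \<and> v_coprime a b"
        using uv us vs by (intro less.hyps) auto
      then obtain g a b where g: "prod_list (us1 @ us2) = g * a"
        "prod_list (u # vs1 @ vs2) = g * b" "v_coprime a b" by blast
      have "prod_list us = (x * g) * a" using us g(1) by (simp add: mult_ac)
      moreover have "prod_list vs = (x * g) * b" using vs u g(2) by (simp add: mult_ac)
      ultimately show ?thesis using g(3) by blast
    qed
    consider (l) x y where "x \<in> set xs" "y \<in> set ys" "x dvd y"
      | (r) x y where "x \<in> set xs" "y \<in> set ys" "y dvd x"
      | (c) "\<forall>x\<in>set xs. \<forall>y\<in>set ys. v_coprime x y"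
      using alt less.prems by blast
    then show ?case
    proof cases
      case l
      then show ?thesis using step less.prems by blast
    next
      case r
      then obtain g a b where g: "prod_list ys = g * a" "prod_list xs = g * b" "v_coprime a b"
        using step[of ys xs y x] less.prems by (auto simp: add.commute)
      have "0 \<notin> set ys" using less.prems nz by blast
      then have "a \<noteq> 0" using g(1) by (auto simp: prod_list_zero_iff)
      then show ?thesis using g v_coprime_sym by blast
    next
      case c
      have one: "v_coprime x (prod_list ys)" if "x \<in> set xs" for x
      proof -
        have "\<forall>y\<in>set ys. v_coprime x y" using c that by blast
        then show ?thesis
          by (induction ys) (auto intro: v_coprime_mult_right, simp add: v_coprime_def)
      qed
      have "v_coprime (prod_list ys) (prod_list xs)"
      proof -
        have "\<forall>x\<in>set xs. v_coprime (prod_list ys) x"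
        proof
          fix x assume "x \<in> set xs"
          moreover have "x \<noteq> 0" using \<open>x \<in> set xs\<close> less.prems(1) nz by blast
          ultimately show "v_coprime (prod_list ys) x" using one v_coprime_sym by blast
        qed
        then show ?thesis
          by (induction xs) (auto intro: v_coprime_mult_right, simp add: v_coprime_def)
      qed
      moreover have "prod_list ys \<noteq> 0"
        using less.prems nz by (auto simp: prod_list_zero_iff)
      ultimately have "v_coprime (prod_list xs) (prod_list ys)" by (rule v_coprime_sym)
      then show ?thesis by (metis mult_1)
    qed
  qed
  have "\<exists>g. gcd_of g {a, b}" for a b :: 'a
  proof (cases "a = 0 \<or> b = 0")
    case True
    then have "gcd_of (if a = 0 then b else a) {a, b}" by (auto simp: gcd_of_pair)
    then show ?thesis ..
  next
    case False
    then obtain g a' b' where g: "a = g * a'" "b = g * b'" "v_coprime a' b'"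
      using factor[of a] factor[of b] split by metis
    have "c dvd g" if c: "c dvd a" "c dvd b" for c
    proof -
      obtain s t where s: "a = c * s" and t: "b = c * t" using c by (elim dvdE)
      have nz': "a' \<noteq> 0" "g \<noteq> 0" "c \<noteq> 0" using False g s by auto
      have "c * (s * b') = (g * a') * b'" using s g by (simp add: mult.assoc)
      also have "\<dots> = (g * b') * a'" by (simp add: mult_ac)
      also have "\<dots> = c * (t * a')" using t g by (simp add: mult.assoc)
      finally have "s * b' = t * a'" using nz' by simp
      then have "a' dvd b' * s" by (metis dvd_triv_right mult.commute)
      then obtain s' where "s = a' * s'" using g(3) unfolding v_coprime_def by blast
      then have "a' * g = a' * (c * s')" using s g by (simp add: mult_ac)
      then show ?thesis using nz' by simp
    qed
    then have "gcd_of g {a, b}" using g by (simp add: gcd_of_pair)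
    then show ?thesis ..
  qed
  then show ?thesis by (simp add: gcd_domain_iff)
qed

section \<open>Polynomials over a GCD domain\<close>

text \<open>The zero polynomial is not primitive, being divisible by the constant \<open>0\<close>.\<close>

definition primitive :: "'a::idom poly \<Rightarrow> bool" where
  "primitive f \<longleftrightarrow> (\<forall>c. [:c:] dvd f \<longrightarrow> c dvd 1)"

lemma primitive_nonzero: "primitive f \<Longrightarrow> f \<noteq> 0"
  unfolding primitive_def by (metis dvd_0_left_iff dvd_0_right zero_neq_one pCons_0_0)

lemma primitive_divisor: "primitive f \<Longrightarrow> d dvd f \<Longrightarrow> primitive d"
  unfolding primitive_def by (meson dvd_trans)

lemma const_dvd_iff_coeffs: "[:c:] dvd (f::'a::idom poly) \<longleftrightarrow> (\<forall>a\<in>set (coeffs f). c dvd a)"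
  by (simp add: const_poly_dvd_iff forall_coeffs_conv[of "\<lambda>a. c dvd a"])

lemma content_primitive_part:
  assumes G: "gcd_domain TYPE('a::idom)" and "(f::'a poly) \<noteq> 0"
  obtains e f' where "e \<noteq> 0" "f = smult e f'" "primitive f'"
proof -
  obtain e where e: "gcd_of e (set (coeffs f))" using gcd_of_finite_exists[OF G] by blast
  then have "[:e:] dvd f" by (auto simp: const_dvd_iff_coeffs dest: gcd_of_dvd)
  then obtain f' where f': "f = smult e f'" by (auto simp: dvd_def)
  have "e \<noteq> 0" using assms(2) f' by auto
  moreover have "primitive f'"
    unfolding primitive_def
  proof (intro allI impI)
    fix c assume "[:c:] dvd f'"
    then have "[:e * c:] dvd f" unfolding f' by (auto simp: const_poly_dvd_iff intro: mult_dvd_mono)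
    then have "e * c dvd e * 1" using e by (simp add: const_dvd_iff_coeffs gcd_of_def)
    then show "c dvd 1" using \<open>e \<noteq> 0\<close> by (metis dvd_mult_cancel_left)
  qed
  ultimately show thesis using that f' by blast
qed

lemma const_dvd_smult_primitive:
  assumes G: "gcd_domain TYPE('a::idom)" and f: "primitive (f::'a poly)"
    and "[:c:] dvd smult e f"
  shows "c dvd e"
proof -
  have "gcd_of 1 (set (coeffs f))"
    using f by (auto simp: gcd_of_def primitive_def const_dvd_iff_coeffs intro: dvd_trans)
  then have "gcd_of (e * 1) ((*) e ` set (coeffs f))" by (intro gcd_of_scale[OF G]) auto
  moreover have "c dvd e * a" if "a \<in> set (coeffs f)" for a
  proof -
    obtain n where "a = coeff f n"
      using \<open>a \<in> set (coeffs f)\<close> by (metis coeffs_def empty_iff empty_set imageE list.set_map)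
    then show ?thesis using assms(3) by (simp add: const_poly_dvd_iff)
  qed
  ultimately show ?thesis by (auto simp: gcd_of_def)
qed

text \<open>Gauss's lemma. A constant dividing \<open>fg\<close> divides the product of the two leading coefficients, so
  it splits into constants \<open>c1\<close> and \<open>c2\<close> that divide \<open>fg\<close> and one leading coefficient each. If \<open>c1\<close>
  divides the leading term of \<open>f\<close>, then it divides \<open>(f - lead f) g\<close>; by induction on the degree it
  then divides the content of \<open>f - lead f\<close>, hence \<open>f\<close>, so it is a unit.\<close>

lemma primitive_mult:
  assumes G: "gcd_domain TYPE('a::idom)" and "primitive (f::'a poly)" "primitive g"
  shows "primitive (f * g)"
  using assms(2,3)
proof (induction "degree f + degree g" arbitrary: f g rule: less_induct)
  case less
  have lead: "d dvd 1" if d: "[:d:] dvd p * q" "d dvd lead_coeff p"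
      and pq: "primitive p" "primitive q" "degree p + degree q = degree f + degree g" for d and p q :: "'a poly"
  proof -
    define m where "m = monom (lead_coeff p) (degree p)"
    define p0 where "p0 = p - m"
    have dm: "[:d:] dvd m" using d(2) by (auto simp: m_def const_poly_dvd_iff)
    have "[:d:] dvd p0"
    proof (cases "p0 = 0")
      case False
      have "degree p0 \<le> degree p"
        unfolding p0_def m_def by (simp add: degree_diff_le degree_monom_le)
      moreover have "coeff p0 (degree p) = 0" by (simp add: p0_def m_def)
      ultimately have deg: "degree p0 < degree p" using False
        by (metis leading_coeff_0_iff nat_less_le)
      obtain e p1 where p1: "e \<noteq> 0" "p0 = smult e p1" "primitive p1"
        using content_primitive_part[OF G \<open>p0 \<noteq> 0\<close>] .
      have "primitive (p1 * q)"
        using p1 pq deg by (intro less.hyps) auto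
      moreover have "[:d:] dvd smult e (p1 * q)"
      proof -
        have "smult e (p1 * q) = p0 * q" using p1(2) by simp
        also have "\<dots> = p * q - m * q" by (simp add: p0_def left_diff_distrib)
        finally have "smult e (p1 * q) = p * q - m * q" .
        then show ?thesis using d(1) dm by (simp add: dvd_diff)
      qed
      ultimately have "d dvd e" by (rule const_dvd_smult_primitive[OF G])
      then show ?thesis using p1(2) by (auto simp: const_poly_dvd_iff)
    qed simp
    then have "[:d:] dvd p0 + m" using dm by (rule dvd_add)
    then show ?thesis using pq(1) by (simp add: p0_def primitive_def)
  qed
  show ?case
    unfolding primitive_def
  proof (intro allI impI)
    fix c assume c: "[:c:] dvd f * g"
    have nz: "lead_coeff f * lead_coeff g \<noteq> 0" using less.prems primitive_nonzero by auto
    have ab: "c dvd lead_coeff f * lead_coeff g"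
      using c by (metis const_poly_dvd_iff lead_coeff_mult)
    then have "c \<noteq> 0" using nz by auto
    then obtain c1 c2 where c12: "c = c1 * c2" "c1 dvd lead_coeff f" "c2 dvd lead_coeff g"
      using gcd_domain_primal[OF G _ ab] by blast
    have "[:c1:] dvd f * g" "[:c2:] dvd g * f"
      using c c12(1) by (auto simp: const_poly_dvd_iff mult.commute[of g] intro: dvd_mult_left dvd_mult_right)
    then have "c1 dvd 1" "c2 dvd 1" using lead c12 less.prems by (auto simp: add.commute)
    then show "c dvd 1" using c12(1) by (metis mult_dvd_mono mult_1)
  qed
qed

lemma const_dvd_primitive_mult:
  assumes G: "gcd_domain TYPE('a::idom)" and d: "primitive (d::'a poly)" and "[:c:] dvd d * z"
  shows "[:c:] dvd z"
proof (cases "z = 0")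
  case False
  then obtain e z' where z: "e \<noteq> 0" "z = smult e z'" "primitive z'"
    using content_primitive_part[OF G] by metis
  have "c dvd e"
    using assms(3) z(2) const_dvd_smult_primitive[OF G primitive_mult[OF G d z(3)]] by simp
  then show ?thesis using z(2) by (auto simp: const_poly_dvd_iff)
qed simp

lemma primitive_dvd_smult:
  assumes G: "gcd_domain TYPE('a::idom)" and d: "primitive (d::'a poly)"
    and "c \<noteq> 0" "d dvd smult c f"
  shows "d dvd f"
proof -
  obtain z where z: "smult c f = d * z" using assms(4) ..
  have "[:c:] dvd d * z" unfolding z[symmetric] by (simp add: const_poly_dvd_iff)
  then obtain w where w: "z = [:c:] * w" using const_dvd_primitive_mult[OF G d] by blast
  then have "[:c:] * f = [:c:] * (d * w)" using z by simp
  then have "f = d * w" using \<open>c \<noteq> 0\<close> by (metis mult_left_cancel pCons_eq_0_iff)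
  then show ?thesis by simp
qed

text \<open>The Euclidean algorithm with pseudo-division: up to nonzero constants, which primitive divisors
  do not see, the remainder may be replaced by its primitive part.\<close>

lemma gcd_of_primitive:
  assumes G: "gcd_domain TYPE('a::idom)" and "primitive (f::'a poly)" "primitive g"
  shows "\<exists>h. gcd_of h {f, g}"
  using assms(2,3)
proof (induction "degree g" arbitrary: f g rule: less_induct)
  case less
  have g0: "g \<noteq> 0" using less.prems primitive_nonzero by blast
  define r where "r = pseudo_mod f g"
  obtain a q where a: "a \<noteq> 0" "smult a f = g * q + r"
    using pseudo_mod(1)[OF g0] r_def by metis
  have deg: "r = 0 \<or> degree r < degree g" using pseudo_mod(2)[OF g0] r_def by metis
  show ?case
  proof (cases "r = 0")
    case True
    then have "g dvd f" using a primitive_dvd_smult[OF G less.prems(2)] by (metis add_0_right dvd_triv_left)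
    then have "gcd_of g {f, g}" by (auto simp: gcd_of_pair)
    then show ?thesis ..
  next
    case False
    obtain e r' where r': "e \<noteq> 0" "r = smult e r'" "primitive r'"
      using content_primitive_part[OF G False] .
    have "degree r' < degree g" using deg False r' by simp
    then obtain h where h: "gcd_of h {g, r'}" using less.hyps less.prems(2) r'(3) by blast
    have "c dvd f \<longleftrightarrow> c dvd r'" if "c dvd g" for c
    proof -
      have c: "primitive c" using less.prems(2) that by (rule primitive_divisor)
      have "c dvd f \<longleftrightarrow> c dvd smult a f"
        using primitive_dvd_smult[OF G c a(1)] dvd_smult by blast
      also have "\<dots> \<longleftrightarrow> c dvd r"
        unfolding a(2) using that by (intro dvd_add_right_iff) simp
      also have "\<dots> \<longleftrightarrow> c dvd r'"
        using primitive_dvd_smult[OF G c r'(1)] dvd_smult r'(2) by blast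
      finally show ?thesis .
    qed
    then have "gcd_of h {f, g}" using h by (auto simp: gcd_of_def)
    then show ?thesis ..
  qed
qed

lemma gcd_domain_poly:
  assumes G: "gcd_domain TYPE('a::idom)"
  shows "gcd_domain TYPE('a poly)"
proof -
  have "\<exists>h. gcd_of h {f, g}" for f g :: "'a poly"
  proof (cases "f = 0 \<or> g = 0")
    case True
    then have "gcd_of (if f = 0 then g else f) {f, g}" by (auto simp: gcd_of_pair)
    then show ?thesis ..
  next
    case False
    obtain a f' where f: "a \<noteq> 0" "f = smult a f'" "primitive f'"
      using content_primitive_part[OF G] False by metis
    obtain b g' where g: "b \<noteq> 0" "g = smult b g'" "primitive g'"
      using content_primitive_part[OF G] False by metis
    obtain k where k: "gcd_of k {a, b}" using G by (auto simp: gcd_domain_iff)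
    obtain h where h: "gcd_of h {f', g'}" using gcd_of_primitive[OF G f(3) g(3)] by blast
    have smult_mono: "smult x p dvd smult y q" if "x dvd y" "p dvd q" for x y and p q :: "'a poly"
    proof -
      obtain z r where "y = x * z" "q = p * r" using \<open>x dvd y\<close> \<open>p dvd q\<close> by (elim dvdE)
      then have "smult y q = smult x p * smult z r" by (simp add: mult.commute)
      then show ?thesis by (rule dvdI)
    qed
    have "c dvd smult k h" if c: "c dvd f" "c dvd g" for c
    proof -
      have "c \<noteq> 0" using c(1) False by auto
      then obtain e c' where e: "e \<noteq> 0" "c = smult e c'" "primitive c'"
        using content_primitive_part[OF G] by metis
      have "c' dvd c" "[:e:] dvd c" using e(2) by (simp_all add: const_poly_dvd_iff dvd_smult)
      then have *: "c' dvd f" "c' dvd g" "[:e:] dvd f" "[:e:] dvd g" using c dvd_trans by blast+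
      then have "c' dvd f'" "c' dvd g'"
        using primitive_dvd_smult[OF G e(3)] f g by metis+
      then have "c' dvd h" using h by (simp add: gcd_of_pair)
      moreover have "e dvd a" "e dvd b"
        using * f g const_dvd_smult_primitive[OF G] by metis+
      then have "e dvd k" using k by (simp add: gcd_of_pair)
      ultimately show ?thesis using e(2) smult_mono by metis
    qed
    moreover have "smult k h dvd f" "smult k h dvd g"
      using h k f(2) g(2) smult_mono by (simp_all add: gcd_of_pair)
    ultimately have "gcd_of (smult k h) {f, g}" by (simp add: gcd_of_pair)
    then show ?thesis ..
  qed
  then show ?thesis by (simp add: gcd_domain_iff)
qed

lemma const_dvd_const_iff: "[:b:] dvd [:a:] \<longleftrightarrow> b dvd (a::'a::idom)"
  by (auto simp: const_poly_dvd_iff coeff_pCons split: nat.splits)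

lemma divisor_of_const:
  assumes "p dvd [:a:]" "(a::'a::idom) \<noteq> 0"
  obtains b where "p = [:b:]" "b dvd a"
proof -
  have "degree p \<le> degree [:a:]" using assms by (intro dvd_imp_degree_le) auto
  then obtain b where "p = [:b:]" by (metis degree_pCons_0 degree_0_id degree_eq_zeroE le_0_eq)
  then show thesis using that assms const_dvd_const_iff by blast
qed

lemma nz_nonunit_const: "nz_nonunit [:a:] \<longleftrightarrow> nz_nonunit (a::'a::idom)"
  using const_dvd_const_iff[of a 1] by (simp add: nz_nonunit_def one_pCons)

lemma const_prod_list: "[:prod_list xs::'a::idom:] = prod_list (map (\<lambda>x. [:x:]) xs)"
proof (induction xs)
  case (Cons x xs)
  have "[:prod_list (x # xs):] = [:x:] * [:prod_list xs:]" by simp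
  then show ?case unfolding Cons.IH by simp
qed (simp add: one_pCons)

lemma rigid_const:
  assumes "rigid (a::'a::idom)"
  shows "rigid [:a:]"
proof -
  have "a \<noteq> 0" using assms by (simp add: rigid_def nz_nonunit_def)
  then show ?thesis
    using assms unfolding rigid_def nz_nonunit_const
    by (metis divisor_of_const const_dvd_const_iff)
qed

text \<open>A nonunit primitive polynomial is a product of irreducible ones, by induction on the degree, and
  an irreducible element is rigid since its divisors are units or associates of it.\<close>

lemma primitive_product_of_rigid:
  assumes "primitive (g::'a::idom poly)" "\<not> g dvd 1"
  shows "\<exists>xs. (\<forall>x\<in>set xs. rigid x) \<and> g = prod_list xs"
  using assms
proof (induction "degree g" arbitrary: g rule: less_induct)
  case less
  have g0: "g \<noteq> 0" using less.prems primitive_nonzero by blast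
  show ?case
  proof (cases "\<exists>u v. g = u * v \<and> \<not> u dvd 1 \<and> \<not> v dvd 1")
    case True
    then obtain u v where uv: "g = u * v" "\<not> u dvd 1" "\<not> v dvd 1" by blast
    then have prim: "primitive u" "primitive v" using primitive_divisor[OF less.prems(1)] by auto
    have pos: "degree p > 0" if "primitive p" "\<not> p dvd 1" for p :: "'a poly"
    proof (rule ccontr)
      assume "\<not> degree p > 0"
      then obtain c where "p = [:c:]" using degree_eq_zeroE by blast
      then show False using that const_dvd_const_iff[of c 1] by (auto simp: primitive_def one_pCons)
    qed
    have "degree g = degree u + degree v" using uv g0 by (auto intro: degree_mult_eq)
    then have "degree u < degree g" "degree v < degree g" using pos prim uv by auto
    then obtain xs ys where "\<forall>x\<in>set xs. rigid x" "u = prod_list xs"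
      "\<forall>x\<in>set ys. rigid x" "v = prod_list ys"
      using less.hyps prim uv by metis
    then have "(\<forall>x\<in>set (xs @ ys). rigid x) \<and> g = prod_list (xs @ ys)" using uv by auto
    then show ?thesis ..
  next
    case False
    have "b dvd c \<or> c dvd b" if b: "b dvd g" and c: "c dvd g" for b c
    proof -
      obtain u where u: "g = b * u" using b ..
      then consider "b dvd 1" | "u dvd 1" using False by blast
      then show ?thesis
      proof cases
        case 1
        then show ?thesis by (meson dvd_trans one_dvd)
      next
        case 2
        then have "g dvd b" using u by (metis mult_dvd_mono dvd_refl mult_1_right)
        then show ?thesis using c dvd_trans by blast
      qed
    qed
    then have "rigid g" using g0 less.prems by (simp add: rigid_def nz_nonunit_def)
    then have "(\<forall>x\<in>set [g]. rigid x) \<and> g = prod_list [g]" by simp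
    then show ?thesis ..
  qed
qed

lemma poly_product_of_rigid:
  assumes G: "gcd_domain TYPE('a::idom)"
    and D: "\<And>a::'a. nz_nonunit a \<Longrightarrow> \<exists>xs. (\<forall>x\<in>set xs. rigid x) \<and> a = prod_list xs"
    and f: "nz_nonunit (f::'a poly)"
  shows "\<exists>xs. (\<forall>x\<in>set xs. rigid x) \<and> f = prod_list xs"
proof -
  have const: "\<exists>xs. (\<forall>x\<in>set xs. rigid x) \<and> [:a:] = prod_list xs" if a: "nz_nonunit a" for a :: 'a
  proof -
    obtain xs where xs: "\<forall>x\<in>set xs. rigid x" "a = prod_list xs" using D[OF a] by blast
    have "(\<forall>x\<in>set (map (\<lambda>x. [:x:]) xs). rigid x) \<and> [:a:] = prod_list (map (\<lambda>x. [:x:]) xs)"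
      using xs rigid_const const_prod_list[of xs] by auto
    then show ?thesis ..
  qed
  obtain e g where e: "e \<noteq> 0" "f = smult e g" "primitive g"
    using content_primitive_part[OF G] f by (metis nz_nonunit_def)
  consider "degree f = 0" | "e dvd 1" | "degree f \<noteq> 0" "nz_nonunit e"
    using e(1) by (auto simp: nz_nonunit_def)
  then show ?thesis
  proof cases
    case 1
    then obtain a where "f = [:a:]" using degree_eq_zeroE by blast
    then show ?thesis using const f nz_nonunit_const by metis
  next
    case 2
    have "f dvd g"
    proof -
      obtain u where "1 = e * u" using 2 ..
      then have "g = f * [:u:]" using e(2) by (simp add: mult.commute)
      then show ?thesis by (rule dvdI)
    qed
    then show ?thesis
      using primitive_product_of_rigid primitive_divisor[OF e(3)] f by (metis nz_nonunit_def)
  next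
    case 3
    obtain xs where xs: "\<forall>x\<in>set xs. rigid x" "[:e:] = prod_list xs" using const 3 by blast
    have "\<not> g dvd 1"
    proof
      assume "g dvd 1"
      then obtain u where "g = [:u:]" using divisor_of_const[of g 1] by (auto simp: one_pCons)
      then show False using 3 e by simp
    qed
    then obtain ys where ys: "\<forall>x\<in>set ys. rigid x" "g = prod_list ys"
      using primitive_product_of_rigid e(3) by blast
    have "f = [:e:] * g" using e(2) by simp
    then have "(\<forall>x\<in>set (xs @ ys). rigid x) \<and> f = prod_list (xs @ ys)"
      using xs ys by auto
    then show ?thesis ..
  qed
qed

section \<open>The \<open>v\<close>- and \<open>t\<close>-closure\<close>

lemma to_fract_in_base_ring [simp]: "to_fract x \<in> base_ring"
  by (simp add: base_ring_def)

lemma base_ringE: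
  assumes "x \<in> base_ring" obtains r where "x = to_fract r"
  using assms by (auto simp: base_ring_def)

lemma base_ring_one [simp]: "1 \<in> base_ring"
  by (metis to_fract_1 to_fract_in_base_ring)

lemma base_ring_add: "x \<in> base_ring \<Longrightarrow> y \<in> base_ring \<Longrightarrow> x + y \<in> base_ring"
  by (metis base_ringE to_fract_add to_fract_in_base_ring)

lemma base_ring_mult: "x \<in> base_ring \<Longrightarrow> y \<in> base_ring \<Longrightarrow> x * y \<in> base_ring"
  by (metis base_ringE to_fract_mult to_fract_in_base_ring)

lemma to_fract_power: "to_fract (x ^ n) = to_fract x ^ n"
  by (induction n) auto

lemma fraction_cases:
  obtains p q where "q \<noteq> 0" "w = to_fract p / to_fract q"
  by (cases w rule: Fract_cases) (auto simp: Fract_conv_to_fract)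

lemma quotient_in_base_ring_iff:
  assumes "q \<noteq> 0"
  shows "to_fract p / to_fract q \<in> base_ring \<longleftrightarrow> q dvd p"
proof
  assume "to_fract p / to_fract q \<in> base_ring"
  then obtain r where "to_fract p / to_fract q = to_fract r" by (rule base_ringE)
  then have "to_fract p = to_fract (q * r)" using assms by (simp add: field_simps)
  then show "q dvd p" by (simp only: to_fract_eq_iff dvd_triv_left)
next
  assume "q dvd p"
  then show "to_fract p / to_fract q \<in> base_ring" using assms by (auto elim!: dvdE)
qed

lemma subspace_base_ring: "dsub.subspace base_ring"
  by (rule dsub.subspaceI)
    (auto simp: fract_scale_def base_ring_add base_ring_mult intro: to_fract_in_base_ring[of 0, simplified])

lemma subspace_mult: "dsub.subspace A \<Longrightarrow> x \<in> A \<Longrightarrow> r \<in> base_ring \<Longrightarrow> r * x \<in> A"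
  using dsub.subspace_scale[of A x] by (auto simp: fract_scale_def base_ring_def)

lemma subspaceI_mult:
  assumes "0 \<in> A" "\<And>x y. x \<in> A \<Longrightarrow> y \<in> A \<Longrightarrow> x + y \<in> A" "\<And>r x. x \<in> A \<Longrightarrow> to_fract r * x \<in> A"
  shows "dsub.subspace A"
  using assms by (intro dsub.subspaceI) (auto simp: fract_scale_def)

lemma subspace_colon: "dsub.subspace B \<Longrightarrow> dsub.subspace {x. w * x \<in> B}"
  by (rule subspaceI_mult)
    (auto simp: dsub.subspace_0 distrib_left dsub.subspace_add mult.left_commute[of w] subspace_mult)

lemma mult_span_in:
  assumes "dsub.subspace B" "\<And>s. s \<in> S \<Longrightarrow> w * s \<in> B" "x \<in> dsub.span S"
  shows "w * x \<in> B"
  using dsub.span_minimal[of S "{x. w * x \<in> B}"] subspace_colon[OF assms(1), of w] assms(2,3) by blast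

lemma span_eq_zero_iff: "dsub.span S = {0} \<longleftrightarrow> S \<subseteq> {0}"
  by (metis dsub.span_empty dsub.span_mono dsub.span_superset dsub.subspace_single_0
      dsub.span_minimal dsub.span_zero empty_subsetI subset_singletonD singletonD subset_antisym
      insert_subset)

lemma v_closure_iff:
  "x \<in> v_closure A \<longleftrightarrow> (\<forall>w. (\<forall>a\<in>A. w * a \<in> base_ring) \<longrightarrow> w * x \<in> base_ring)"
  by (auto simp: v_closure_def ideal_inv_def mult.commute)

lemma v_closure_span_iff:
  "x \<in> v_closure (dsub.span S) \<longleftrightarrow> (\<forall>w. (\<forall>a\<in>S. w * a \<in> base_ring) \<longrightarrow> w * x \<in> base_ring)"
proof -
  have "(\<forall>a\<in>dsub.span S. w * a \<in> base_ring) \<longleftrightarrow> (\<forall>a\<in>S. w * a \<in> base_ring)" for w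
    using mult_span_in[OF subspace_base_ring] dsub.span_base by blast
  then show ?thesis by (simp add: v_closure_iff)
qed

lemma subset_v_closure: "A \<subseteq> v_closure A"
  by (auto simp: v_closure_iff)

lemma v_closure_subset: "A \<subseteq> v_closure B \<Longrightarrow> v_closure A \<subseteq> v_closure B"
  unfolding v_closure_iff subset_iff by blast

lemma ideal_inv_v_closure: "ideal_inv (v_closure A) = ideal_inv A"
  by (auto simp: ideal_inv_def v_closure_iff)

lemma v_closure_in_base_ring: "A \<subseteq> base_ring \<Longrightarrow> v_closure A \<subseteq> base_ring"
  unfolding v_closure_iff subset_iff by (metis mult_1)

lemma subspace_v_closure: "dsub.subspace (v_closure A)"
proof (rule subspaceI_mult)
  show "0 \<in> v_closure A"
    unfolding v_closure_iff by (metis mult_zero_right to_fract_0 to_fract_in_base_ring)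
  show "x + y \<in> v_closure A" if "x \<in> v_closure A" "y \<in> v_closure A" for x y
    using that by (auto simp: v_closure_iff distrib_left base_ring_add)
  show "to_fract r * x \<in> v_closure A" if "x \<in> v_closure A" for r x
    using that base_ring_mult[OF to_fract_in_base_ring] unfolding v_closure_iff
    by (metis mult.left_commute)
qed

lemma v_closure_scale:
  assumes "z \<in> v_closure A" "(*) c ` A \<subseteq> B"
  shows "c * z \<in> v_closure B"
  unfolding v_closure_iff
proof (intro allI impI)
  fix w assume "\<forall>b\<in>B. w * b \<in> base_ring"
  then have "\<forall>a\<in>A. (w * c) * a \<in> base_ring" using assms(2) by (auto simp: mult.assoc)
  then have "(w * c) * z \<in> base_ring" using assms(1) by (auto simp: v_closure_iff)
  then show "w * (c * z) \<in> base_ring" by (simp add: mult.assoc)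
qed

text \<open>This is the inclusion of powers of \<open>A\<^sub>v\<close> in the \<open>v\<close>-closure of the corresponding power of \<open>A\<close>: in
  a product of \<open>k\<close> elements of \<open>A\<close> the factors can be replaced by \<open>z\<close> one at a time.\<close>

lemma v_closure_power:
  assumes z: "z \<in> v_closure A"
    and "\<And>us. set us \<subseteq> A \<Longrightarrow> length us = k \<Longrightarrow> w * prod_list us \<in> base_ring"
  shows "w * z ^ k \<in> base_ring"
  using assms(2)
proof (induction k arbitrary: w)
  case 0
  then show ?case using "0"[of "[]"] by simp
next
  case (Suc k)
  have "\<forall>u\<in>A. (w * z ^ k) * u \<in> base_ring"
  proof
    fix u assume u: "u \<in> A"
    have "(w * u) * z ^ k \<in> base_ring"
    proof (rule Suc.IH)
      fix us assume "set us \<subseteq> A" "length us = k"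
      then show "(w * u) * prod_list us \<in> base_ring"
        using Suc.prems[of "u # us"] u by (simp add: mult.assoc)
    qed
    then show "(w * z ^ k) * u \<in> base_ring" by (simp add: mult_ac)
  qed
  then have "(w * z ^ k) * z \<in> base_ring" using z by (auto simp: v_closure_iff)
  then show ?case by (simp add: mult_ac)
qed

lemma common_denominator:
  assumes "finite S"
  shows "\<exists>d. d \<noteq> 0 \<and> (\<forall>s\<in>S. to_fract d * s \<in> base_ring)"
  using assms
proof (induction S)
  case empty
  have "(1::'a) \<noteq> 0" by simp
  then show ?case by blast
next
  case (insert x S)
  then obtain d where d: "d \<noteq> 0" "\<forall>s\<in>S. to_fract d * s \<in> base_ring" by blast
  obtain p q where q: "q \<noteq> 0" "x = to_fract p / to_fract q" by (rule fraction_cases)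
  have "to_fract (q * d) * x = to_fract (d * p)" using q by simp
  moreover have "to_fract (q * d) * s \<in> base_ring" if "s \<in> S" for s
    using d(2) that base_ring_mult[OF to_fract_in_base_ring[of q]] by (auto simp: mult.assoc)
  ultimately have "\<forall>s\<in>insert x S. to_fract (q * d) * s \<in> base_ring"
    by (metis insertE to_fract_in_base_ring)
  moreover have "q * d \<noteq> 0" using q d by simp
  ultimately show ?case by blast
qed

lemma nz_fractional_span:
  assumes "finite S" "\<not> S \<subseteq> {0}"
  shows "nz_fractional_ideal (dsub.span S)"
proof -
  obtain d where "d \<noteq> 0" "\<forall>s\<in>S. to_fract d * s \<in> base_ring"
    using common_denominator[OF assms(1)] by blast
  then have "d \<noteq> 0 \<and> (\<forall>x\<in>dsub.span S. to_fract d * x \<in> base_ring)"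
    using mult_span_in[OF subspace_base_ring] by blast
  then show ?thesis
    using assms(2) by (auto simp: nz_fractional_ideal_def fractional_ideal_def span_eq_zero_iff)
qed

lemma nz_fractional_v_closure:
  assumes "nz_fractional_ideal A"
  shows "nz_fractional_ideal (v_closure A)"
proof -
  obtain d where "d \<noteq> 0" "\<forall>x\<in>A. to_fract d * x \<in> base_ring"
    using assms by (auto simp: nz_fractional_ideal_def fractional_ideal_def)
  then have "d \<noteq> 0 \<and> (\<forall>x\<in>v_closure A. to_fract d * x \<in> base_ring)"
    by (auto simp: v_closure_iff)
  moreover have "v_closure A \<noteq> {0}"
    using assms subset_v_closure[of A] dsub.subspace_0
    by (auto simp: nz_fractional_ideal_def fractional_ideal_def)
  ultimately show ?thesis
    using subspace_v_closure by (auto simp: nz_fractional_ideal_def fractional_ideal_def)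
qed

lemma nz_fractional_integral:
  "dsub.subspace A \<Longrightarrow> A \<subseteq> base_ring \<Longrightarrow> A \<noteq> {0} \<Longrightarrow> nz_fractional_ideal A"
  unfolding nz_fractional_ideal_def fractional_ideal_def
  by (metis mult_1 subsetD to_fract_1 zero_neq_one)

lemma t_closure_alt:
  "t_closure A = \<Union> {v_closure (dsub.span S) | S. finite S \<and> S \<subseteq> A \<and> \<not> S \<subseteq> {0}}"
  if "dsub.subspace A"
proof -
  have "(I \<subseteq> A \<and> nz_fractional_ideal I \<and> fin_gen I)
      \<longleftrightarrow> (\<exists>S. finite S \<and> S \<subseteq> A \<and> \<not> S \<subseteq> {0} \<and> I = dsub.span S)" for I
  proof
    assume I: "I \<subseteq> A \<and> nz_fractional_ideal I \<and> fin_gen I"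
    then obtain S where S: "finite S" "I = dsub.span S" by (auto simp: fin_gen_def)
    then have "S \<subseteq> A" "\<not> S \<subseteq> {0}"
      using I dsub.span_superset[of S] span_eq_zero_iff[of S] by (auto simp: nz_fractional_ideal_def)
    then show "\<exists>S. finite S \<and> S \<subseteq> A \<and> \<not> S \<subseteq> {0} \<and> I = dsub.span S" using S by blast
  next
    assume "\<exists>S. finite S \<and> S \<subseteq> A \<and> \<not> S \<subseteq> {0} \<and> I = dsub.span S"
    then obtain S where S: "finite S" "S \<subseteq> A" "\<not> S \<subseteq> {0}" "I = dsub.span S" by blast
    then show "I \<subseteq> A \<and> nz_fractional_ideal I \<and> fin_gen I"
      using nz_fractional_span[OF S(1,3)] dsub.span_minimal[OF S(2) that]
      by (auto simp: fin_gen_def)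
  qed
  then show ?thesis unfolding t_closure_def by (simp only:) (rule arg_cong[of _ _ Union], blast)
qed

lemma subset_t_closure:
  assumes "dsub.subspace A" "A \<noteq> {0}"
  shows "A \<subseteq> t_closure A"
proof
  fix x assume x: "x \<in> A"
  obtain a where a: "a \<in> A" "a \<noteq> 0" using assms dsub.subspace_0 by blast
  have "x \<in> v_closure (dsub.span {x, a})" by (auto simp: v_closure_span_iff)
  moreover have "finite {x, a} \<and> {x, a} \<subseteq> A \<and> \<not> {x, a} \<subseteq> {0}" using x a by simp
  ultimately show "x \<in> t_closure A" unfolding t_closure_alt[OF assms(1)] by blast
qed

lemma t_ideal_iff:
  "t_ideal A \<longleftrightarrow> nz_fractional_ideal A
    \<and> (\<forall>S. finite S \<and> S \<subseteq> A \<and> \<not> S \<subseteq> {0} \<longrightarrow> v_closure (dsub.span S) \<subseteq> A)"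
proof (cases "nz_fractional_ideal A")
  case True
  then have A: "dsub.subspace A" "A \<noteq> {0}"
    by (auto simp: nz_fractional_ideal_def fractional_ideal_def)
  have "t_closure A \<subseteq> A
    \<longleftrightarrow> (\<forall>S. finite S \<and> S \<subseteq> A \<and> \<not> S \<subseteq> {0} \<longrightarrow> v_closure (dsub.span S) \<subseteq> A)"
    unfolding t_closure_alt[OF A(1)] by blast
  then show ?thesis using True subset_t_closure[OF A] by (auto simp: t_ideal_def)
qed (simp add: t_ideal_def)

lemma t_ideal_subspace: "t_ideal A \<Longrightarrow> dsub.subspace A"
  by (simp add: t_ideal_def nz_fractional_ideal_def fractional_ideal_def)

lemma t_ideal_nonzero: "t_ideal A \<Longrightarrow> \<exists>a\<in>A. a \<noteq> 0"
  using dsub.subspace_0 t_ideal_subspace by (auto simp: t_ideal_def nz_fractional_ideal_def)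

lemma t_ideal_v_closure:
  assumes "finite S" "\<not> S \<subseteq> {0}"
  shows "t_ideal (v_closure (dsub.span S))"
proof -
  have "v_closure (dsub.span T) \<subseteq> v_closure (dsub.span S)" if "T \<subseteq> v_closure (dsub.span S)" for T
    using that dsub.span_minimal subspace_v_closure v_closure_subset by metis
  then show ?thesis
    using nz_fractional_v_closure[OF nz_fractional_span[OF assms]] by (auto simp: t_ideal_iff)
qed

section \<open>Maximal \<open>t\<close>-ideals\<close>

lemma proper_subspace: "dsub.subspace A \<Longrightarrow> A \<subseteq> base_ring \<Longrightarrow> A \<subset> base_ring \<longleftrightarrow> 1 \<notin> A"
  using subspace_mult[of A 1] base_ring_one by (metis mult.right_neutral psubset_eq subsetI subset_antisym)

lemma t_ideal_chain_Union:
  assumes ne: "C \<noteq> {}" and chain: "subset.chain {N. t_ideal N \<and> N \<subset> base_ring} C"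
  shows "t_ideal (\<Union>C) \<and> \<Union>C \<subset> base_ring"
proof -
  have t: "t_ideal N" "N \<subset> base_ring" if "N \<in> C" for N
    using chain that by (auto simp: subset.chain_def)
  have fin: "\<exists>N\<in>C. S \<subseteq> N" if "finite S" "S \<subseteq> \<Union>C" for S
    using finite_subset_Union_chain[OF that ne chain] by blast
  have sub: "dsub.subspace (\<Union>C)"
  proof (rule subspaceI_mult)
    show "0 \<in> \<Union>C" using ne t t_ideal_subspace dsub.subspace_0 by blast
    show "x + y \<in> \<Union>C" if xy: "x \<in> \<Union>C" "y \<in> \<Union>C" for x y
    proof -
      obtain N where N: "N \<in> C" "{x, y} \<subseteq> N" using fin[of "{x, y}"] xy by auto
      then have "x + y \<in> N" using dsub.subspace_add[OF t_ideal_subspace[OF t(1)]] by simp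
      then show ?thesis using N(1) by blast
    qed
    show "to_fract r * x \<in> \<Union>C" if x: "x \<in> \<Union>C" for r x
    proof -
      obtain N where "N \<in> C" "x \<in> N" using x by blast
      then show ?thesis
        using subspace_mult[OF t_ideal_subspace[OF t(1)[OF \<open>N \<in> C\<close>]] \<open>x \<in> N\<close>, of "to_fract r"]
        by auto
    qed
  qed
  have base: "\<Union>C \<subseteq> base_ring" using t by blast
  have "1 \<notin> N" if "N \<in> C" for N
    using t[OF that] proper_subspace[OF t_ideal_subspace] by blast
  then have "\<Union>C \<subset> base_ring" using proper_subspace[OF sub base] by blast
  moreover have "\<Union>C \<noteq> {0}" using ne t_ideal_nonzero t by blast
  moreover have "v_closure (dsub.span S) \<subseteq> \<Union>C" if S: "finite S" "S \<subseteq> \<Union>C" "\<not> S \<subseteq> {0}" for S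
  proof -
    obtain N where "N \<in> C" "S \<subseteq> N" using fin S by blast
    then have "v_closure (dsub.span S) \<subseteq> N" using S t by (auto simp: t_ideal_iff)
    then show ?thesis using \<open>N \<in> C\<close> by blast
  qed
  ultimately show ?thesis
    using nz_fractional_integral[OF sub base] by (auto simp: t_ideal_iff)
qed

lemma maximal_t_ideal_exists:
  assumes "t_ideal A" "A \<subset> base_ring"
  obtains M where "maximal_t_ideal M" "A \<subseteq> M"
proof -
  let ?Z = "{N. t_ideal N \<and> N \<subset> base_ring \<and> A \<subseteq> N}"
  have "\<exists>M\<in>?Z. \<forall>X\<in>?Z. M \<subseteq> X \<longrightarrow> X = M"
  proof (rule subset_Zorn_nonempty)
    show "?Z \<noteq> {}" using assms by blast
    fix C assume C: "C \<noteq> {}" "subset.chain ?Z C"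
    then have "subset.chain {N. t_ideal N \<and> N \<subset> base_ring} C"
      by (auto simp: subset.chain_def)
    then have "t_ideal (\<Union>C) \<and> \<Union>C \<subset> base_ring" by (rule t_ideal_chain_Union[OF C(1)])
    moreover have "A \<subseteq> \<Union>C" using C unfolding subset.chain_def by blast
    ultimately show "\<Union>C \<in> ?Z" by blast
  qed
  then obtain M where M: "M \<in> ?Z" "\<forall>X\<in>?Z. M \<subseteq> X \<longrightarrow> X = M" by blast
  then have "maximal_t_ideal M" unfolding maximal_t_ideal_def by (blast intro: subset_trans)
  then show thesis using that M by blast
qed

text \<open>The colon ideal \<open>(M : a)\<close> is again a \<open>t\<close>-ideal containing \<open>M\<close>, and it is proper if \<open>a \<notin> M\<close>. By
  maximality it equals \<open>M\<close>.\<close>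

lemma maximal_t_ideal_prime:
  assumes M: "maximal_t_ideal M"
  shows "prime_ideal M"
  unfolding prime_ideal_def
proof (intro conjI ballI impI)
  have t: "t_ideal M" and "M \<subset> base_ring" using M by (auto simp: maximal_t_ideal_def)
  then show sub: "dsub.subspace M" and "M \<subset> base_ring" by (auto dest: t_ideal_subspace)
  fix a b assume a: "a \<in> base_ring" and b: "b \<in> base_ring" and ab: "a * b \<in> M"
  show "a \<in> M \<or> b \<in> M"
  proof (cases "a \<in> M")
    case False
    define N where "N = {x. a * x \<in> M} \<inter> base_ring"
    have N: "dsub.subspace N"
      unfolding N_def by (intro dsub.subspace_inter subspace_colon sub subspace_base_ring)
    have MN: "M \<subseteq> N"
      using \<open>M \<subset> base_ring\<close> subspace_mult[OF sub _ a] by (auto simp: N_def)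
    have "1 \<notin> N" using False by (simp add: N_def)
    then have proper: "N \<subset> base_ring" using proper_subspace[OF N] by (auto simp: N_def)
    have "v_closure (dsub.span S) \<subseteq> N" if S: "finite S" "S \<subseteq> N" "\<not> S \<subseteq> {0}" for S
    proof
      fix z assume z: "z \<in> v_closure (dsub.span S)"
      have "a \<noteq> 0" using False sub dsub.subspace_0 by blast
      then have aS: "finite ((*) a ` S)" "(*) a ` S \<subseteq> M" "\<not> (*) a ` S \<subseteq> {0}"
        using S by (auto simp: N_def)
      have "a * z \<in> v_closure (dsub.span ((*) a ` S))"
        using z
      proof (rule v_closure_scale)
        show "(*) a ` dsub.span S \<subseteq> dsub.span ((*) a ` S)"
          by (auto intro: mult_span_in[OF dsub.subspace_span] dsub.span_base)
      qed
      then have "a * z \<in> M" using t aS by (auto simp: t_ideal_iff)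
      moreover have "dsub.span S \<subseteq> base_ring"
        using S by (intro dsub.span_minimal subspace_base_ring) (auto simp: N_def)
      then have "z \<in> base_ring" using z v_closure_in_base_ring by blast
      ultimately show "z \<in> N" by (simp add: N_def)
    qed
    moreover have "N \<noteq> {0}" using MN t_ideal_nonzero[OF t] by blast
    ultimately have "t_ideal N"
      using nz_fractional_integral[OF N] proper by (auto simp: t_ideal_iff)
    then have "N = M" using M MN proper by (auto simp: maximal_t_ideal_def)
    then show ?thesis using ab b by (auto simp: N_def)
  qed simp
qed

lemma maximal_t_ideal_prime_t: "maximal_t_ideal M \<Longrightarrow> prime_t_ideal M"
  by (simp add: prime_t_ideal_def maximal_t_ideal_prime maximal_t_ideal_def)

lemma prime_ideal_dvd: "prime_ideal P \<Longrightarrow> to_fract x \<in> P \<Longrightarrow> x dvd y \<Longrightarrow> to_fract y \<in> P"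
  using subspace_mult[of P "to_fract x"] by (auto simp: prime_ideal_def mult.commute elim!: dvdE)

lemma prime_ideal_mult_iff:
  "prime_ideal P \<Longrightarrow> to_fract (x * y) \<in> P \<longleftrightarrow> to_fract x \<in> P \<or> to_fract y \<in> P"
  using prime_ideal_dvd[of P] dvd_triv_left dvd_triv_right unfolding prime_ideal_def
  by (metis to_fract_in_base_ring to_fract_mult)

lemma prime_ideal_not_unit: "prime_ideal P \<Longrightarrow> x dvd 1 \<Longrightarrow> to_fract x \<notin> P"
  using prime_ideal_dvd[of P x 1] proper_subspace[of P] by (auto simp: prime_ideal_def)

lemma prime_ideal_power: "prime_ideal P \<Longrightarrow> to_fract (x ^ n) \<in> P \<Longrightarrow> to_fract x \<in> P"
proof (induction n)
  case 0
  then show ?case using prime_ideal_not_unit[of P 1] by simp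
next
  case (Suc n)
  then show ?case using prime_ideal_mult_iff[of P x "x ^ n"] by auto
qed

lemma prime_ideal_prod_list:
  "prime_ideal P \<Longrightarrow> to_fract (prod_list xs) \<in> P \<longleftrightarrow> (\<exists>x\<in>set xs. to_fract x \<in> P)"
proof (induction xs)
  case Nil
  then show ?case using prime_ideal_not_unit[of P 1] by simp
next
  case (Cons x xs)
  then show ?case using prime_ideal_mult_iff[of P x "prod_list xs"] by simp
qed

text \<open>Both sides say \<open>(x, y)\<^sub>v = D\<close>: a \<open>w \<in> K\<close> with \<open>wx, wy \<in> D\<close> has the form \<open>z/x\<close> with \<open>x\<close> dividing
  \<open>yz\<close>, and a proper \<open>(x, y)\<^sub>v\<close> lies in a maximal \<open>t\<close>-ideal.\<close>

lemma v_coprime_iff_no_common_maximal_t_ideal: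
  assumes "(x::'a::idom) \<noteq> 0"
  shows "v_coprime x y \<longleftrightarrow> (\<forall>M. maximal_t_ideal M \<longrightarrow> to_fract x \<notin> M \<or> to_fract y \<notin> M)"
proof -
  let ?S = "{to_fract x, to_fract y}"
  let ?A = "v_closure (dsub.span ?S)"
  have one: "1 \<in> ?A \<longleftrightarrow> v_coprime x y"
  proof
    assume A: "1 \<in> ?A"
    show "v_coprime x y"
      unfolding v_coprime_def
    proof (intro allI impI)
      fix z assume z: "x dvd y * z"
      have "to_fract z / to_fract x * to_fract y \<in> base_ring"
        using z quotient_in_base_ring_iff[OF assms, of "y * z"] by (simp add: mult.commute)
      then have "\<forall>a\<in>?S. to_fract z / to_fract x * a \<in> base_ring" using assms by simp
      then have "to_fract z / to_fract x * 1 \<in> base_ring" using A unfolding v_closure_span_iff by blast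
      then show "x dvd z" using quotient_in_base_ring_iff[OF assms] by simp
    qed
  next
    assume v: "v_coprime x y"
    have "w \<in> base_ring" if w: "w * to_fract x \<in> base_ring" "w * to_fract y \<in> base_ring" for w
    proof -
      obtain z where "w * to_fract x = to_fract z" using w(1) by (rule base_ringE)
      then have z: "w = to_fract z / to_fract x" using assms by (simp add: field_simps)
      then have "to_fract (y * z) / to_fract x \<in> base_ring" using w(2) by (simp add: mult.commute)
      then have "x dvd z"
        using v quotient_in_base_ring_iff[OF assms] unfolding v_coprime_def by blast
      then show ?thesis using z quotient_in_base_ring_iff[OF assms] by simp
    qed
    then show "1 \<in> ?A" by (auto simp: v_closure_span_iff)
  qed
  have sub: "dsub.span ?S \<subseteq> base_ring" by (intro dsub.span_minimal subspace_base_ring) auto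
  have t: "t_ideal ?A" using assms by (intro t_ideal_v_closure) auto
  have S: "?S \<subseteq> ?A" using dsub.span_superset subset_v_closure by blast
  show ?thesis
  proof (cases "v_coprime x y")
    case True
    have "False" if M: "maximal_t_ideal M" "to_fract x \<in> M" "to_fract y \<in> M" for M
    proof -
      have "?A \<subseteq> M" using M assms by (auto simp: maximal_t_ideal_def t_ideal_iff)
      then have "1 \<in> M" using True one by blast
      then show False
        using prime_ideal_not_unit[OF maximal_t_ideal_prime[OF M(1)], of 1] by simp
    qed
    then show ?thesis using True by blast
  next
    case False
    then have "?A \<subset> base_ring"
      using one proper_subspace[OF subspace_v_closure v_closure_in_base_ring[OF sub]] by blast
    then obtain M where "maximal_t_ideal M" "?A \<subseteq> M" using maximal_t_ideal_exists[OF t] by blast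
    then show ?thesis using False S by blast
  qed
qed

lemma nonunit_in_maximal_t_ideal:
  assumes "nz_nonunit (x::'a::idom)"
  obtains M where "maximal_t_ideal M" "to_fract x \<in> M"
proof -
  have "\<not> v_coprime x x"
    using assms v_coprime_common_divisor[of x x x] by (auto simp: nz_nonunit_def)
  then show thesis
    using that v_coprime_iff_no_common_maximal_t_ideal[of x x] assms by (auto simp: nz_nonunit_def)
qed

lemma prime_ideal_elem:
  assumes "prime_ideal P" "to_fract x \<in> P" "x \<noteq> 0"
  shows "nz_nonunit x"
  using assms prime_ideal_not_unit by (auto simp: nz_nonunit_def)

section \<open>Valuation elements\<close>

text \<open>For \<open>a \<noteq> 0\<close> this is the inclusion \<open>aV \<inter> D \<subseteq> aD\<close>. In terms of quotients, divisibility by \<open>a\<close>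
  becomes a condition on values.\<close>

definition value_saturated :: "'a::idom fract set \<Rightarrow> 'a \<Rightarrow> bool" where
  "value_saturated V a \<longleftrightarrow> (\<forall>x. to_fract x / to_fract a \<in> V \<longrightarrow> a dvd x)"

lemma overring_closed:
  assumes "overring V"
  shows "base_ring \<subseteq> V" "x \<in> V \<Longrightarrow> y \<in> V \<Longrightarrow> x + y \<in> V" "x \<in> V \<Longrightarrow> y \<in> V \<Longrightarrow> x * y \<in> V"
    "x \<in> V \<Longrightarrow> x ^ n \<in> V"
proof -
  show base: "base_ring \<subseteq> V" using assms by (simp add: overring_def)
  show mult: "x * y \<in> V" if "x \<in> V" "y \<in> V" for x y using assms that by (simp add: overring_def)
  have "0 \<in> V" using base to_fract_in_base_ring[of 0] by auto
  then show "x + y \<in> V" if "x \<in> V" "y \<in> V" for x y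
    using assms that unfolding overring_def by (metis diff_0 diff_minus_eq_add)
  show "x ^ n \<in> V" if "x \<in> V" for x n
    using that base base_ring_one by (induction n) (auto intro: mult)
qed

lemma valuation_element_iff:
  "valuation_element a \<longleftrightarrow> nz_nonunit a \<and> (\<exists>V. valuation_overring V \<and> value_saturated V a)"
proof -
  have "(*) (to_fract a) ` V \<inter> base_ring = (*) (to_fract a) ` base_ring \<longleftrightarrow> value_saturated V a"
    if V: "overring V" and a: "a \<noteq> 0" for V
  proof
    assume eq: "(*) (to_fract a) ` V \<inter> base_ring = (*) (to_fract a) ` base_ring"
    show "value_saturated V a"
      unfolding value_saturated_def
    proof (intro allI impI)
      fix x assume "to_fract x / to_fract a \<in> V"
      moreover have "to_fract x = to_fract a * (to_fract x / to_fract a)" using a by simp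
      ultimately have "to_fract x \<in> (*) (to_fract a) ` V \<inter> base_ring"
        by (metis IntI imageI to_fract_in_base_ring)
      then obtain y where "to_fract x = to_fract (a * y)" using eq by (auto simp: base_ring_def)
      then show "a dvd x" by (simp only: to_fract_eq_iff dvd_triv_left)
    qed
  next
    assume s: "value_saturated V a"
    have "(*) (to_fract a) ` V \<inter> base_ring \<subseteq> (*) (to_fract a) ` base_ring"
    proof
      fix x assume "x \<in> (*) (to_fract a) ` V \<inter> base_ring"
      then obtain v r where "v \<in> V" "to_fract r = to_fract a * v" "x = to_fract r"
        by (auto simp: base_ring_def)
      then have "to_fract r / to_fract a \<in> V" using a by simp
      then obtain y where "r = a * y" using s unfolding value_saturated_def by blast
      then show "x \<in> (*) (to_fract a) ` base_ring" using \<open>x = to_fract r\<close> by (metis imageI to_fract_in_base_ring to_fract_mult)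
    qed
    then show "(*) (to_fract a) ` V \<inter> base_ring = (*) (to_fract a) ` base_ring"
      using overring_closed(1)[OF V] by (auto intro: base_ring_mult)
  qed
  then show ?thesis
    unfolding valuation_element_def valuation_overring_def nz_nonunit_def by blast
qed

lemma value_saturated_divisor:
  assumes "value_saturated V a" "b dvd a" "(a::'a::idom) \<noteq> 0"
  shows "value_saturated V b"
  unfolding value_saturated_def
proof (intro allI impI)
  fix x assume x: "to_fract x / to_fract b \<in> V"
  obtain c where c: "a = b * c" using assms(2) ..
  then have "to_fract (x * c) / to_fract a = to_fract x / to_fract b"
    using assms(3) by (simp add: field_simps)
  then have "b * c dvd x * c" using assms(1) x c unfolding value_saturated_def by metis
  then show "b dvd x" using c assms(3) by simp
qed

lemma value_saturated_power:
  assumes V: "overring V" and a: "value_saturated V a" "(a::'a::idom) \<noteq> 0"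
  shows "value_saturated V (a ^ n)"
proof (induction n)
  case 0
  then show ?case by (simp add: value_saturated_def)
next
  case (Suc n)
  show ?case
    unfolding value_saturated_def
  proof (intro allI impI)
    fix x assume x: "to_fract x / to_fract (a ^ Suc n) \<in> V"
    have "to_fract (a ^ n) * (to_fract x / to_fract (a ^ Suc n)) \<in> V"
      using x overring_closed(1)[OF V] by (intro overring_closed(3)[OF V]) auto
    then have "to_fract x / to_fract a \<in> V" using a(2) by (simp add: to_fract_power)
    then obtain y where y: "x = a * y" using a(1) unfolding value_saturated_def by blast
    then have "to_fract y / to_fract (a ^ n) \<in> V" using x a(2) by simp
    then show "a ^ Suc n dvd x" using Suc y by (auto simp: value_saturated_def)
  qed
qed

lemma value_saturated_comparable:
  assumes V: "valuation_overring V" and "value_saturated V a" "value_saturated V b"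
    and "(a::'a::idom) \<noteq> 0" "b \<noteq> 0"
  shows "a dvd b \<or> b dvd a"
proof -
  have "to_fract a / to_fract b \<in> V \<or> inverse (to_fract a / to_fract b) \<in> V"
    using V assms(4,5) unfolding valuation_overring_def by (metis divide_eq_0_iff to_fract_eq_0_iff)
  then show ?thesis using assms(2,3) by (auto simp: value_saturated_def)
qed

lemma valuation_element_divisor:
  "valuation_element a \<Longrightarrow> b dvd a \<Longrightarrow> \<not> b dvd 1 \<Longrightarrow> valuation_element b"
  unfolding valuation_element_iff nz_nonunit_def
  using value_saturated_divisor by (metis dvd_0_left)

lemma valuation_element_power_divisors:
  assumes "valuation_element (a::'a::idom)" "b dvd a ^ n" "c dvd a ^ n"
  shows "b dvd c \<or> c dvd b"
proof -
  obtain V where V: "valuation_overring V" "value_saturated V a" and a: "a \<noteq> 0"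
    using assms(1) by (auto simp: valuation_element_iff nz_nonunit_def)
  have "value_saturated V (a ^ n)" "a ^ n \<noteq> 0"
    using V a value_saturated_power by (auto simp: valuation_overring_def)
  then show ?thesis
    using value_saturated_comparable[OF V(1)] value_saturated_divisor assms(2,3)
    by (metis dvd_0_left)
qed

lemma valuation_element_rigid: "valuation_element a \<Longrightarrow> rigid a"
  using valuation_element_power_divisors[of a _ 1]
  by (auto simp: rigid_def valuation_element_iff)

lemma valuation_overring_finite_max:
  assumes V: "valuation_overring V" and "finite S" "\<not> S \<subseteq> {0}"
  shows "\<exists>y\<in>S. y \<noteq> 0 \<and> (\<forall>s\<in>S. s / y \<in> V)"
  using assms(2,3)
proof (induction S)
  case (insert x S)
  have over: "overring V" using V by (simp add: valuation_overring_def)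
  have c: "0 \<in> V" "1 \<in> V"
    using overring_closed(1)[OF over] to_fract_in_base_ring[of 0] base_ring_one by auto
  show ?case
  proof (cases "S \<subseteq> {0}")
    case True
    then have "x \<noteq> 0" "\<forall>s\<in>insert x S. s / x \<in> V" using insert.prems c by auto
    then show ?thesis by blast
  next
    case False
    then obtain y where y: "y \<in> S" "y \<noteq> 0" "\<forall>s\<in>S. s / y \<in> V" using insert.IH by blast
    show ?thesis
    proof (cases "x / y \<in> V")
      case True
      then show ?thesis using y by blast
    next
      case False
      then have x: "x \<noteq> 0" using c by auto
      then have yx: "y / x \<in> V"
        using V False y(2) unfolding valuation_overring_def
        by (metis divide_eq_0_iff inverse_divide)
      have "s / x \<in> V" if "s \<in> S" for s
      proof -
        have "s / x = (s / y) * (y / x)" using y(2) by simp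
        then show ?thesis using overring_closed(3)[OF over] y(3) yx that by metis
      qed
      then show ?thesis using x c by auto
    qed
  qed
qed simp

definition radical :: "'a::idom \<Rightarrow> 'a fract set" where
  "radical a = {to_fract x | x. \<exists>n. a dvd x ^ n}"

lemma in_radical_iff: "to_fract x \<in> radical a \<longleftrightarrow> (\<exists>n. a dvd x ^ n)"
  by (auto simp: radical_def)

lemma radical_subset_prime:
  assumes P: "prime_ideal P" and a: "to_fract a \<in> P"
  shows "radical a \<subseteq> P"
proof
  fix u assume "u \<in> radical a"
  then obtain x n where "u = to_fract x" "a dvd x ^ n" by (auto simp: radical_def)
  then show "u \<in> P" using prime_ideal_power[OF P] prime_ideal_dvd[OF P a] by blast
qed

text \<open>Divisibility by \<open>a\<close> is detected by the valuation, so membership in the radical of \<open>aD\<close> depends on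
  values only; this makes it prime. For the \<open>t\<close>-closure, let \<open>y\<close> be an element of smallest value in a
  finite subset of the radical and \<open>y\<^sup>m \<in> aD\<close>. All \<open>m\<close>-fold products of elements of the generated
  ideal \<open>I\<close> lie in \<open>y\<^sup>mV \<inter> D \<subseteq> aV \<inter> D = aD\<close>, so \<open>z\<^sup>m \<in> aD\<close> for all \<open>z \<in> I\<^sub>v\<close>.\<close>

lemma valuation_element_radical_prime_t_ideal:
  assumes "valuation_element (a::'a::idom)"
  shows "prime_t_ideal (radical a)"
proof -
  obtain V where V: "valuation_overring V" "value_saturated V a" and a: "a \<noteq> 0" "\<not> a dvd 1"
    using assms by (auto simp: valuation_element_iff nz_nonunit_def)
  have over: "overring V" using V by (simp add: valuation_overring_def)
  have base: "to_fract x \<in> V" for x using overring_closed(1)[OF over] by auto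
  have quot: "to_fract x / to_fract a \<in> V" if "a dvd x" for x
    using that a(1) quotient_in_base_ring_iff[of a x] overring_closed(1)[OF over] by blast
  have smaller: "\<exists>n. a dvd x ^ n"
    if y: "a dvd y ^ m" "y \<noteq> 0" "to_fract x / to_fract y \<in> V" for x y m
  proof -
    have "to_fract (x ^ m) / to_fract a
        = (to_fract x / to_fract y) ^ m * (to_fract (y ^ m) / to_fract a)"
      using y(2) by (simp add: to_fract_power field_simps)
    also have "\<dots> \<in> V" by (intro overring_closed(3,4)[OF over] y(3) quot y(1))
    finally show ?thesis using V(2) unfolding value_saturated_def by blast
  qed
  have total: "to_fract x / to_fract y \<in> V \<or> to_fract y / to_fract x \<in> V"
    if "x \<noteq> 0" "y \<noteq> 0" for x y
    using V(1) that unfolding valuation_overring_def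
    by (metis divide_eq_0_iff inverse_divide to_fract_eq_0_iff)
  have add: "\<exists>n. a dvd (x + y) ^ n"
    if x: "a dvd x ^ n" and y: "a dvd y ^ m" "y \<noteq> 0" "to_fract x / to_fract y \<in> V" for x y n m
  proof (rule smaller[OF y(1,2)])
    have "to_fract (x + y) / to_fract y = to_fract x / to_fract y + to_fract 1"
      using y(2) by (simp add: field_simps)
    then show "to_fract (x + y) / to_fract y \<in> V" using y(3) base overring_closed(2)[OF over] by metis
  qed
  have sub: "dsub.subspace (radical a)"
  proof (rule subspaceI_mult)
    show "0 \<in> radical a" unfolding radical_def using power_0_left[of 1]
      by (auto intro!: exI[of _ 0] exI[of _ 1])
    fix u v assume "u \<in> radical a" "v \<in> radical a"
    then obtain x y n m where x: "u = to_fract x" "a dvd x ^ n" and y: "v = to_fract y" "a dvd y ^ m"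
      by (auto simp: radical_def)
    show "u + v \<in> radical a"
    proof (cases "x = 0 \<or> y = 0")
      case True
      then show ?thesis using x y \<open>u \<in> radical a\<close> \<open>v \<in> radical a\<close> by auto
    next
      case False
      then have "\<exists>n. a dvd (x + y) ^ n"
        using total[of x y] add[OF x(2) y(2)] add[OF y(2) x(2)] by (auto simp: add.commute)
      then have "to_fract (x + y) \<in> radical a" by (simp only: in_radical_iff)
      then show ?thesis using x(1) y(1) by simp
    qed
  next
    fix r u assume "u \<in> radical a"
    then obtain x n where x: "u = to_fract x" "a dvd x ^ n" by (auto simp: radical_def)
    then have "a dvd (r * x) ^ n" by (simp add: power_mult_distrib)
    then have "to_fract (r * x) \<in> radical a" by (auto simp only: in_radical_iff)
    then show "to_fract r * u \<in> radical a" using x(1) by simp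
  qed
  have int: "radical a \<subseteq> base_ring" by (auto simp: radical_def)
  have "to_fract 1 \<notin> radical a" unfolding in_radical_iff using a(2) by simp
  then have proper: "radical a \<subset> base_ring" using proper_subspace[OF sub int] by simp
  have mult: "\<exists>k. a dvd x ^ k" if xy: "a dvd (x * y) ^ n" "y \<noteq> 0" "to_fract x / to_fract y \<in> V"
    for x y n
  proof -
    have "to_fract (x ^ (2 * n)) / to_fract a
        = (to_fract x / to_fract y) ^ n * (to_fract ((x * y) ^ n) / to_fract a)"
      using xy(2) by (simp add: to_fract_power field_simps power_mult power2_eq_square power_mult_distrib)
    also have "\<dots> \<in> V" by (intro overring_closed(3,4)[OF over] xy(3) quot xy(1))
    finally show ?thesis using V(2) unfolding value_saturated_def by blast
  qed
  have "u \<in> radical a \<or> v \<in> radical a"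
    if uv: "u \<in> base_ring" "v \<in> base_ring" "u * v \<in> radical a" for u v
  proof -
    obtain x y where x: "u = to_fract x" and y: "v = to_fract y"
      using uv(1,2) by (auto elim!: base_ringE)
    then have "to_fract (x * y) \<in> radical a" using uv(3) by simp
    then obtain n where n: "a dvd (x * y) ^ n" unfolding in_radical_iff ..
    show ?thesis
    proof (cases "x = 0 \<or> y = 0")
      case True
      then show ?thesis using x y dsub.subspace_0[OF sub] by auto
    next
      case False
      then have "(\<exists>k. a dvd x ^ k) \<or> (\<exists>k. a dvd y ^ k)"
        using total[of x y] mult[OF n] mult[of y x n] n by (auto simp: mult.commute)
      then show ?thesis unfolding x y in_radical_iff .
    qed
  qed
  then have prime: "prime_ideal (radical a)" using sub proper by (simp add: prime_ideal_def)
  have "v_closure (dsub.span S) \<subseteq> radical a"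
    if S: "finite S" "S \<subseteq> radical a" "\<not> S \<subseteq> {0}" for S
  proof
    fix z assume z: "z \<in> v_closure (dsub.span S)"
    have span: "dsub.span S \<subseteq> base_ring"
      using S int by (intro dsub.span_minimal subspace_base_ring) auto
    then obtain z' where z': "z = to_fract z'"
      using z v_closure_in_base_ring base_ringE by blast
    obtain y where y: "y \<in> S" "y \<noteq> 0" "\<forall>s\<in>S. s / y \<in> V"
      using valuation_overring_finite_max[OF V(1) S(1,3)] by blast
    obtain y' m where y': "y = to_fract y'" "a dvd y' ^ m"
      using y(1) S(2) by (auto simp: radical_def)
    have subV: "dsub.subspace V"
      using base[of 0] by (intro subspaceI_mult overring_closed(2,3)[OF over] base) auto
    have spanV: "inverse y * u \<in> V" if "u \<in> dsub.span S" for u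
      using that y(3) by (intro mult_span_in[OF subV _ that]) (auto simp: field_simps)
    have "1 / to_fract a * prod_list us \<in> base_ring"
      if us: "set us \<subseteq> dsub.span S" "length us = m" for us
    proof -
      have "prod_list us \<in> base_ring"
        using us(1) span by (induction us arbitrary: m) (auto intro: base_ring_mult)
      then obtain p where p: "prod_list us = to_fract p" by (rule base_ringE)
      have "inverse y ^ length us * prod_list us \<in> V"
        using us(1)
      proof (induction us)
        case Nil
        then show ?case using base[of 1] by simp
      next
        case (Cons u us)
        have "inverse y ^ length (u # us) * prod_list (u # us)
            = (inverse y * u) * (inverse y ^ length us * prod_list us)" by (simp add: mult_ac)
        also have "\<dots> \<in> V"
          using Cons spanV overring_closed(3)[OF over] by simp
        finally show ?case .
      qed
      moreover have "to_fract (y' ^ m) / to_fract a \<in> V" using quot[OF y'(2)] .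
      ultimately have "(inverse y ^ m * prod_list us) * (to_fract (y' ^ m) / to_fract a) \<in> V"
        unfolding us(2) by (rule overring_closed(3)[OF over])
      moreover have "(inverse y ^ m * prod_list us) * (to_fract (y' ^ m) / to_fract a)
          = to_fract p / to_fract a"
        using p y' y(2) by (simp add: to_fract_power field_simps)
      ultimately have "a dvd p" using V(2) unfolding value_saturated_def by metis
      then show ?thesis using p quotient_in_base_ring_iff[OF a(1)] by simp
    qed
    then have "1 / to_fract a * z ^ m \<in> base_ring" by (rule v_closure_power[OF z])
    then have "to_fract (z' ^ m) / to_fract a \<in> base_ring" using z' by (simp add: to_fract_power)
    then have "a dvd z' ^ m" using quotient_in_base_ring_iff[OF a(1)] by blast
    then show "z \<in> radical a" unfolding z' in_radical_iff ..
  qed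
  moreover have "radical a \<noteq> {0}"
    using in_radical_iff[of a a] a(1) by (metis dvd_refl power_one_right singletonD to_fract_eq_0_iff)
  ultimately have "t_ideal (radical a)"
    using nz_fractional_integral[OF sub int] by (auto simp: t_ideal_iff)
  then show ?thesis using prime by (simp add: prime_t_ideal_def)
qed

lemma valuation_elements_comparable:
  assumes T: "t_treed TYPE('a::idom)" and x: "valuation_element (x::'a)" and y: "valuation_element y"
    and M: "maximal_t_ideal M" "to_fract x \<in> M" "to_fract y \<in> M"
  shows "x dvd y \<or> y dvd x"
proof -
  have cmp: "u dvd w \<or> w dvd u"
    if u: "valuation_element u" and w: "valuation_element w" and uw: "radical u \<subseteq> radical w" for u w :: 'a
  proof -
    have "to_fract u \<in> radical u" unfolding in_radical_iff by (metis dvd_refl power_one_right)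
    then obtain n where n: "w dvd u ^ n" using uw in_radical_iff by blast
    moreover have "n \<noteq> 0" using n w by (cases n) (auto simp: valuation_element_iff nz_nonunit_def)
    ultimately show ?thesis
      using valuation_element_power_divisors[OF u, of u n w] by (auto simp: dvd_power)
  qed
  have "radical x \<subseteq> M" "radical y \<subseteq> M"
    using radical_subset_prime maximal_t_ideal_prime M by blast+
  then have "radical x \<subseteq> radical y \<or> radical y \<subseteq> radical x"
    using T valuation_element_radical_prime_t_ideal x y maximal_t_ideal_prime_t[OF M(1)]
    unfolding t_treed_def by blast
  then show ?thesis using cmp x y by blast
qed

text \<open>If \<open>a\<close> lay in two maximal \<open>t\<close>-ideals \<open>M\<close> and \<open>N\<close>, there would be valuation elements \<open>x\<close> and \<open>y\<close>
  in \<open>M - N\<close> and \<open>N - M\<close>. Below \<open>M\<close> the radicals of \<open>a\<close> and \<open>x\<close> are comparable, and that of \<open>a\<close> is the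
  smaller one because it lies in \<open>N\<close>. So \<open>x\<close> divides a power of \<open>a\<close>, and so does \<open>y\<close>; but divisors of
  a power of a valuation element are comparable.\<close>

lemma valuation_element_homogeneous:
  assumes T: "t_treed TYPE('a::idom)" and F: "vfd TYPE('a)" and a: "valuation_element (a::'a)"
  shows "homogeneous a"
proof -
  have nz: "nz_nonunit a" using a by (simp add: valuation_element_def)
  have sep: "\<exists>x n. valuation_element x \<and> to_fract x \<in> M \<and> to_fract x \<notin> N \<and> x dvd a ^ n"
    if M: "maximal_t_ideal M" "to_fract a \<in> M" and N: "maximal_t_ideal N" "to_fract a \<in> N"
      and "M \<noteq> N" for M N
  proof -
    note pM = maximal_t_ideal_prime[OF M(1)] and pN = maximal_t_ideal_prime[OF N(1)]
    have "\<not> M \<subseteq> N" using M(1) N(1) \<open>M \<noteq> N\<close> unfolding maximal_t_ideal_def by blast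
    then obtain z where z: "to_fract z \<in> M" "to_fract z \<notin> N"
      using pM unfolding prime_ideal_def by (metis base_ringE psubsetD subsetI)
    have "z \<noteq> 0" using z(2) pN dsub.subspace_0[of N] by (auto simp: prime_ideal_def)
    then obtain xs where xs: "\<forall>x\<in>set xs. valuation_element x" "z = prod_list xs"
      using F prime_ideal_elem[OF pM z(1)] unfolding vfd_def by blast
    then obtain x where x: "x \<in> set xs" "to_fract x \<in> M"
      using z(1) prime_ideal_prod_list[OF pM] by blast
    have xN: "to_fract x \<notin> N" using x(1) xs z(2) prime_ideal_prod_list[OF pN] by blast
    have vx: "valuation_element x" using x xs by blast
    have "radical x \<subseteq> M" "radical a \<subseteq> M" "radical a \<subseteq> N"
      using radical_subset_prime pM pN M N x by blast+
    moreover have "to_fract x \<in> radical x" "to_fract a \<in> radical a"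
      unfolding in_radical_iff by (metis dvd_refl power_one_right)+
    ultimately have "to_fract a \<in> radical x"
      using T valuation_element_radical_prime_t_ideal[OF a]
        valuation_element_radical_prime_t_ideal[OF vx] maximal_t_ideal_prime_t[OF M(1)] xN
      unfolding t_treed_def by blast
    then show ?thesis using vx x(2) xN in_radical_iff by blast
  qed
  have "M = N" if M: "maximal_t_ideal M" "to_fract a \<in> M" and N: "maximal_t_ideal N" "to_fract a \<in> N"
    for M N
  proof (rule ccontr)
    assume "M \<noteq> N"
    obtain x n where x: "to_fract x \<in> M" "to_fract x \<notin> N" "x dvd a ^ n"
      using sep[OF M N \<open>M \<noteq> N\<close>] by blast
    obtain y m where y: "to_fract y \<in> N" "to_fract y \<notin> M" "y dvd a ^ m"
      using sep[OF N M] \<open>M \<noteq> N\<close> by blast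
    have "x dvd a ^ (n + m)" "y dvd a ^ (n + m)" using x y by (simp_all add: power_add)
    then have "x dvd y \<or> y dvd x" using valuation_element_power_divisors[OF a] by blast
    then show False
      using x y prime_ideal_dvd maximal_t_ideal_prime M(1) N(1) by blast
  qed
  then show ?thesis
    using nz nonunit_in_maximal_t_ideal[OF nz] unfolding homogeneous_def by metis
qed

lemma vfd_imp_hofd:
  "t_treed TYPE('a::idom) \<Longrightarrow> vfd TYPE('a) \<Longrightarrow> hofd TYPE('a)"
  using valuation_element_homogeneous unfolding vfd_def hofd_def by metis

lemma product_with_units:
  assumes "\<And>a::'a::idom. nz_nonunit a \<Longrightarrow> \<exists>xs. (\<forall>x\<in>set xs. Q x) \<and> a = prod_list xs" "(a::'a) \<noteq> 0"
  shows "\<exists>xs. set xs \<subseteq> {x. x dvd 1 \<or> Q x} \<and> a = prod_list xs"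
proof (cases "a dvd 1")
  case True
  then have "set [a] \<subseteq> {x. x dvd 1 \<or> Q x} \<and> a = prod_list [a]" by simp
  then show ?thesis by blast
next
  case False
  then show ?thesis using assms unfolding nz_nonunit_def by blast
qed

lemma treed_vfd_imp_gcd_domain:
  assumes T: "t_treed TYPE('a::idom)" and F: "vfd TYPE('a)"
  shows "gcd_domain TYPE('a)"
proof (rule gcd_domain_if_generated)
  let ?H = "{x::'a. x dvd 1 \<or> valuation_element x}"
  show "\<exists>xs. set xs \<subseteq> ?H \<and> a = prod_list xs" if "a \<noteq> 0" for a
    using product_with_units[OF _ that, of valuation_element] F unfolding vfd_def by blast
  show "y \<in> ?H" if "x \<in> ?H" "y dvd x" for x y
    using that valuation_element_divisor dvd_trans by blast
  show "0 \<notin> ?H" by (simp add: valuation_element_def nz_nonunit_def)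
  show "x dvd y \<or> y dvd x \<or> v_coprime x y" if "x \<in> ?H" "y \<in> ?H" for x y
  proof (cases "x dvd 1 \<or> y dvd 1")
    case True
    then show ?thesis by (meson dvd_trans one_dvd)
  next
    case False
    then have v: "valuation_element x" "valuation_element y" using that by auto
    then have "x \<noteq> 0" by (simp add: valuation_element_def nz_nonunit_def)
    then show ?thesis
      using valuation_elements_comparable[OF T v] v_coprime_iff_no_common_maximal_t_ideal by blast
  qed
qed

section \<open>Homogeneous factorizations\<close>

lemma homogeneous_divisor:
  assumes "homogeneous x" "y dvd x" "\<not> y dvd 1"
  shows "homogeneous y"
proof -
  have y: "nz_nonunit y" using assms by (auto simp: homogeneous_def nz_nonunit_def)
  have "to_fract x \<in> M" if "maximal_t_ideal M" "to_fract y \<in> M" for M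
    using that assms(2) prime_ideal_dvd maximal_t_ideal_prime by blast
  then show ?thesis
    using assms(1) y nonunit_in_maximal_t_ideal[OF y] unfolding homogeneous_def by metis
qed

lemma hofd_imp_weakly_matlis:
  assumes "hofd TYPE('a::idom)"
  shows "weakly_matlis TYPE('a)"
proof -
  have "finite {M. maximal_t_ideal M \<and> to_fract x \<in> M}" if x: "nz_nonunit x" for x :: 'a
  proof -
    obtain xs where xs: "\<forall>y\<in>set xs. homogeneous y" "x = prod_list xs"
      using assms x unfolding hofd_def by blast
    have "finite {M. maximal_t_ideal M \<and> to_fract y \<in> M}" if y: "y \<in> set xs" for y
    proof -
      have "homogeneous y" using xs(1) y by blast
      then obtain N where "\<forall>M. maximal_t_ideal M \<and> to_fract y \<in> M \<longrightarrow> M = N"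
        unfolding homogeneous_def by metis
      then have "{M. maximal_t_ideal M \<and> to_fract y \<in> M} \<subseteq> {N}" by blast
      then show ?thesis by (rule finite_subset) simp
    qed
    moreover have "{M. maximal_t_ideal M \<and> to_fract x \<in> M}
        \<subseteq> (\<Union>y\<in>set xs. {M. maximal_t_ideal M \<and> to_fract y \<in> M})"
      using prime_ideal_prod_list[OF maximal_t_ideal_prime] unfolding xs(2) by auto
    ultimately show ?thesis by (meson finite_UN finite_set finite_subset)
  qed
  moreover have False
    if MN: "maximal_t_ideal M" "maximal_t_ideal N" "M \<noteq> N"
      and P: "prime_ideal P" "P \<noteq> {0}" "P \<subseteq> M" "P \<subseteq> N" for M N P :: "'a fract set"
  proof -
    have "dsub.subspace P" "P \<subseteq> base_ring" using P(1) by (auto simp: prime_ideal_def)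
    moreover from this obtain u where "u \<in> P" "u \<noteq> 0" using P(2) dsub.subspace_0[of P] by blast
    ultimately obtain x where x: "to_fract x \<in> P" "x \<noteq> 0"
      by (metis base_ringE subsetD to_fract_0)
    then obtain xs where xs: "\<forall>y\<in>set xs. homogeneous y" "x = prod_list xs"
      using assms prime_ideal_elem[OF P(1)] unfolding hofd_def by blast
    then obtain y where "y \<in> set xs" "to_fract y \<in> P"
      using x(1) prime_ideal_prod_list[OF P(1)] by blast
    then show False using xs(1) MN P(3,4) unfolding homogeneous_def by blast
  qed
  ultimately show ?thesis unfolding weakly_matlis_def finite_t_character_def by blast
qed

text \<open>Since \<open>(x, y)\<close> is \<open>t\<close>-invertible, some \<open>u \<in> (x, y)\<^sup>-\<^sup>1\<close> moves \<open>x\<close> (say) out of the common maximal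
  \<open>t\<close>-ideal: \<open>s = xu \<notin> M\<close>. Then \<open>sy = (yu)x\<close> is a multiple of \<open>x\<close>, and \<open>x\<close> is v-coprime to
  \<open>s\<close> because \<open>M\<close> is the only maximal \<open>t\<close>-ideal containing \<open>x\<close>.\<close>

lemma homogeneous_comparable_in_pvmd:
  assumes P: "pvmd TYPE('a::idom)" and x: "homogeneous (x::'a)" and y: "homogeneous y"
    and M: "maximal_t_ideal M" "to_fract x \<in> M" "to_fract y \<in> M"
  shows "x dvd y \<or> y dvd x"
proof -
  let ?S = "{to_fract x, to_fract y}"
  let ?I = "dsub.span ?S"
  have nz: "x \<noteq> 0" "y \<noteq> 0" using x y by (auto simp: homogeneous_def nz_nonunit_def)
  have "?I \<subseteq> base_ring" by (intro dsub.span_minimal subspace_base_ring) auto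
  moreover have "?I \<noteq> {0}" using nz by (simp add: span_eq_zero_iff)
  moreover have "fin_gen ?I" unfolding fin_gen_def by (intro exI[of _ ?S]) simp
  ultimately have "t_invertible ?I" using P unfolding pvmd_def by blast
  then have base: "t_closure (ideal_prod ?I (ideal_inv ?I)) = base_ring"
    by (simp add: t_invertible_def)
  have tM: "t_ideal M" "M \<subset> base_ring" using M by (auto simp: maximal_t_ideal_def)
  have "\<not> ideal_prod ?I (ideal_inv ?I) \<subseteq> M"
  proof
    assume "ideal_prod ?I (ideal_inv ?I) \<subseteq> M"
    then have "t_closure (ideal_prod ?I (ideal_inv ?I)) \<subseteq> t_closure M"
      unfolding t_closure_def by blast
    then show False using tM base by (auto simp: t_ideal_def)
  qed
  moreover have sub: "dsub.subspace M" using tM t_ideal_subspace by blast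
  have "ideal_prod ?I (ideal_inv ?I) \<subseteq> M" if "\<forall>a\<in>?I. \<forall>u\<in>ideal_inv ?I. a * u \<in> M"
    unfolding ideal_prod_def using that by (intro dsub.span_minimal sub) auto
  ultimately obtain a u where u: "u \<in> ideal_inv ?I" and a: "a \<in> ?I" "a * u \<notin> M" by metis
  have "\<exists>s\<in>?S. u * s \<notin> M"
    using mult_span_in[OF sub, of ?S u a] a by (metis mult.commute)
  moreover have uS: "u * to_fract x \<in> base_ring" "u * to_fract y \<in> base_ring"
    using u dsub.span_base[of _ ?S] by (auto simp: ideal_inv_def)
  moreover have dvd: "b dvd c"
    if b: "homogeneous b" "to_fract b \<in> M" and bc: "u * to_fract b \<in> base_ring"
      "u * to_fract c \<in> base_ring" "u * to_fract b \<notin> M" for b c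
  proof -
    have b0: "b \<noteq> 0" using b(1) by (simp add: homogeneous_def nz_nonunit_def)
    obtain s t where s: "u * to_fract b = to_fract s" and t: "u * to_fract c = to_fract t"
      using bc(1,2) by (auto elim!: base_ringE)
    have "to_fract (s * c) = to_fract (b * t)" by (simp add: s[symmetric] t[symmetric])
    then have "b dvd s * c" by (simp only: to_fract_eq_iff dvd_triv_left)
    moreover have "v_coprime b s"
      unfolding v_coprime_iff_no_common_maximal_t_ideal[OF b0]
      using b M(1) bc(3) s unfolding homogeneous_def by metis
    ultimately show ?thesis unfolding v_coprime_def by blast
  qed
  ultimately show ?thesis using dvd[OF x M(2)] dvd[OF y M(3)] by auto
qed

lemma hofd_pvmd_imp_gcd_domain:
  assumes F: "hofd TYPE('a::idom)" and P: "pvmd TYPE('a)"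
  shows "gcd_domain TYPE('a)"
proof (rule gcd_domain_if_generated)
  let ?H = "{x::'a. x dvd 1 \<or> homogeneous x}"
  show "\<exists>xs. set xs \<subseteq> ?H \<and> a = prod_list xs" if "a \<noteq> 0" for a
    using product_with_units[OF _ that, of homogeneous] F unfolding hofd_def by blast
  show "y \<in> ?H" if "x \<in> ?H" "y dvd x" for x y
    using that homogeneous_divisor dvd_trans by blast
  show "0 \<notin> ?H" by (simp add: homogeneous_def nz_nonunit_def)
  show "x dvd y \<or> y dvd x \<or> v_coprime x y" if "x \<in> ?H" "y \<in> ?H" for x y
  proof (cases "x dvd 1 \<or> y dvd 1")
    case True
    then show ?thesis by (meson dvd_trans one_dvd)
  next
    case False
    then have h: "homogeneous x" "homogeneous y" using that by auto
    then have "x \<noteq> 0" by (simp add: homogeneous_def nz_nonunit_def)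
    then show ?thesis
      using homogeneous_comparable_in_pvmd[OF P h] v_coprime_iff_no_common_maximal_t_ideal by blast
  qed
qed

lemma homogeneous_rigid:
  assumes G: "gcd_domain TYPE('a::idom)" and a: "homogeneous (a::'a)"
  shows "rigid a"
proof -
  have nz: "nz_nonunit a" using a by (simp add: homogeneous_def)
  have "b dvd c \<or> c dvd b" if b: "b dvd a" and c: "c dvd a" for b c
  proof -
    have b0: "b \<noteq> 0" and c0: "c \<noteq> 0" using b c nz by (auto simp: nz_nonunit_def)
    obtain g b' c' where g: "b = g * b'" "c = g * c'" "v_coprime b' c'"
      using gcd_cofactors[OF G b0] by metis
    have dvd: "b' dvd a" "c' dvd a" using b c g dvd_mult_right by metis+
    have "b' dvd 1 \<or> c' dvd 1"
    proof (rule ccontr)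
      assume "\<not> (b' dvd 1 \<or> c' dvd 1)"
      moreover have bc0: "b' \<noteq> 0" "c' \<noteq> 0" using b0 c0 g by auto
      ultimately have "nz_nonunit b'" "nz_nonunit c'" by (auto simp: nz_nonunit_def)
      then obtain M N where M: "maximal_t_ideal M" "to_fract b' \<in> M"
        and N: "maximal_t_ideal N" "to_fract c' \<in> N"
        using nonunit_in_maximal_t_ideal by metis
      have "to_fract a \<in> M" "to_fract a \<in> N"
        using M N dvd prime_ideal_dvd maximal_t_ideal_prime by blast+
      then have "M = N" using a M(1) N(1) unfolding homogeneous_def by blast
      then show False
        using g(3) M N v_coprime_iff_no_common_maximal_t_ideal[OF bc0(1)] by blast
    qed
    then show ?thesis
    proof
      assume "b' dvd 1"
      then have "g * b' dvd g * c'" by (meson dvd_refl dvd_trans mult_dvd_mono one_dvd)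
      then show ?thesis using g by simp
    next
      assume "c' dvd 1"
      then have "g * c' dvd g * b'" by (meson dvd_refl dvd_trans mult_dvd_mono one_dvd)
      then show ?thesis using g by simp
    qed
  qed
  then show ?thesis using nz by (simp add: rigid_def)
qed

text \<open>The valuation overring is the ring of fractions with denominators coprime to \<open>a\<close>. In a reduced
  fraction \<open>p/q\<close> one of \<open>gcd(a, p)\<close> and \<open>gcd(a, q)\<close> divides the other by rigidity, so it divides
  \<open>gcd(p, q) = 1\<close>; hence \<open>q/p\<close> or \<open>p/q\<close> has an admissible denominator.\<close>

lemma rigid_imp_valuation_element:
  assumes G: "gcd_domain TYPE('a::idom)" and a: "rigid (a::'a)"
  shows "valuation_element a"
proof -
  have a0: "a \<noteq> 0" "nz_nonunit a" using a by (auto simp: rigid_def nz_nonunit_def)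
  define V where "V = {to_fract x / to_fract s | x s. s \<noteq> 0 \<and> v_coprime a s}"
  have VI: "to_fract x / to_fract s \<in> V" if "s \<noteq> 0" "v_coprime a s" for x s
    using that unfolding V_def by blast
  have over: "overring V"
    unfolding overring_def
  proof (intro conjI ballI subsetI)
    fix u :: "'a fract" assume "u \<in> base_ring"
    then obtain x where "u = to_fract x" by (rule base_ringE)
    then show "u \<in> V" using VI[of 1 x] by (simp add: v_coprime_def)
  next
    fix u v assume "u \<in> V" "v \<in> V"
    then obtain x s y t where u: "u = to_fract x / to_fract s" "s \<noteq> 0" "v_coprime a s"
      and v: "v = to_fract y / to_fract t" "t \<noteq> 0" "v_coprime a t"
      unfolding V_def by blast
    have st: "s * t \<noteq> 0" "v_coprime a (s * t)" using u v v_coprime_mult_right by auto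
    have "u - v = to_fract (x * t - y * s) / to_fract (s * t)"
      unfolding u(1) v(1) using u(2) v(2) by (simp add: diff_frac_eq)
    then show "u - v \<in> V" using VI[OF st] by metis
    have "u * v = to_fract (x * y) / to_fract (s * t)" using u v by simp
    then show "u * v \<in> V" using VI[OF st] by metis
  qed
  have "w \<in> V \<or> inverse w \<in> V" if w: "w \<noteq> 0" for w
  proof -
    obtain p q where pq: "q \<noteq> 0" "w = to_fract p / to_fract q" by (rule fraction_cases)
    then have p0: "p \<noteq> 0" using w by auto
    obtain g p' q' where g: "p = g * p'" "q = g * q'" "v_coprime p' q'"
      using gcd_cofactors[OF G p0] by metis
    have nz: "g \<noteq> 0" "p' \<noteq> 0" "q' \<noteq> 0" using g pq p0 by auto
    have w': "w = to_fract p' / to_fract q'" using pq g nz by simp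
    obtain h k where h: "gcd_of h {a, p'}" and k: "gcd_of k {a, q'}"
      using G by (metis gcd_domain_iff)
    have coprime: "v_coprime a r" if "gcd_of e {a, r}" "e dvd 1" for e r
      using that by (intro gcd_one_imp_v_coprime[OF G]) (auto simp: gcd_of_pair intro: dvd_trans)
    have "h dvd k \<or> k dvd h" using a h k by (simp add: rigid_def gcd_of_pair)
    then have "h dvd 1 \<or> k dvd 1"
      using v_coprime_common_divisor[OF g(3) nz(2)] h k by (meson dvd_trans gcd_of_pair)
    then have "v_coprime a p' \<or> v_coprime a q'" using coprime h k by blast
    then show ?thesis using VI[OF nz(2)] VI[OF nz(3)] w' by auto
  qed
  then have "valuation_overring V" using over by (simp add: valuation_overring_def)
  moreover have "value_saturated V a"
    unfolding value_saturated_def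
  proof (intro allI impI)
    fix x assume "to_fract x / to_fract a \<in> V"
    then obtain y s where s: "to_fract x / to_fract a = to_fract y / to_fract s" "s \<noteq> 0"
      "v_coprime a s" unfolding V_def by blast
    then have "to_fract (s * x) = to_fract (a * y)" using a0(1) by (simp add: field_simps)
    then have "a dvd s * x" by (simp only: to_fract_eq_iff dvd_triv_left)
    then show "a dvd x" using s(3) unfolding v_coprime_def by blast
  qed
  ultimately show ?thesis using a0(2) valuation_element_iff by blast
qed

lemma gcd_hofd_imp_vfd:
  "gcd_domain TYPE('a::idom) \<Longrightarrow> hofd TYPE('a) \<Longrightarrow> vfd TYPE('a)"
  unfolding hofd_def vfd_def using homogeneous_rigid rigid_imp_valuation_element by blast

text \<open>Consider the set \<open>Q\<close> of all elements that divide no product \<open>st\<close> with \<open>s \<notin> M\<close> and \<open>t \<notin> N\<close>. In a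
  GCD domain \<open>Q\<close> is a prime ideal: of two coprime elements one lies outside \<open>M\<close>, so if \<open>Q\<close> contains
  \<open>y\<close> and \<open>z\<close>, it contains \<open>gcd(y, z)\<close>, hence \<open>y + z\<close>. As \<open>Q\<close> is contained in \<open>M\<close> and \<open>N\<close>, which
  have no nonzero prime ideal in common, it is zero.\<close>

lemma weakly_matlis_gcd_separation:
  assumes G: "gcd_domain TYPE('a::idom)" and W: "weakly_matlis TYPE('a)"
    and M: "maximal_t_ideal M" and N: "maximal_t_ideal N" and "M \<noteq> N" and x: "(x::'a) \<noteq> 0"
  obtains s t where "to_fract s \<notin> M" "to_fract t \<notin> N" "x dvd s * t"
proof -
  note pM = maximal_t_ideal_prime[OF M] and pN = maximal_t_ideal_prime[OF N]
  define B where "B z \<longleftrightarrow> (\<exists>s t. to_fract s \<notin> M \<and> to_fract t \<notin> N \<and> z dvd s * t)" for z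
  define Q where "Q = {to_fract z | z. \<not> B z}"
  have Q: "to_fract z \<in> Q \<longleftrightarrow> \<not> B z" for z unfolding Q_def by auto
  have B_mult: "B (y * z)" if yz: "B y" "B z" for y z
  proof -
    obtain s t s' t' where s: "to_fract s \<notin> M" "to_fract t \<notin> N" "y dvd s * t"
      and s': "to_fract s' \<notin> M" "to_fract t' \<notin> N" "z dvd s' * t'"
      using yz unfolding B_def by blast
    have "y * z dvd (s * s') * (t * t')"
      using mult_dvd_mono[OF s(3) s'(3)] by (simp add: mult_ac)
    moreover have "to_fract (s * s') \<notin> M" "to_fract (t * t') \<notin> N"
      using s s' prime_ideal_mult_iff[OF pM] prime_ideal_mult_iff[OF pN] by blast+
    ultimately show ?thesis unfolding B_def by blast
  qed
  have B_dvd: "B y" if "B z" "y dvd z" for y z using that unfolding B_def by (meson dvd_trans)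
  have one: "to_fract 1 \<notin> M" "to_fract 1 \<notin> N"
    using prime_ideal_not_unit[OF pM dvd_refl] prime_ideal_not_unit[OF pN dvd_refl] by simp_all
  have B_M: "B z" if "to_fract z \<notin> M" for z
    unfolding B_def using that one by (intro exI[of _ z] exI[of _ 1]) auto
  have B_N: "B z" if "to_fract z \<notin> N" for z
    unfolding B_def using that one by (intro exI[of _ 1] exI[of _ z]) auto
  have B_add: "\<not> B (y + z)" if y: "\<not> B y" and z: "\<not> B z" for y z
  proof (cases "y = 0")
    case False
    obtain g y' z' where g: "y = g * y'" "z = g * z'" "v_coprime y' z'"
      using gcd_cofactors[OF G False] by metis
    have "y' \<noteq> 0" using False g by auto
    then have "to_fract y' \<notin> M \<or> to_fract z' \<notin> M"
      using g(3) M v_coprime_iff_no_common_maximal_t_ideal by blast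
    then have "\<not> B g" using B_mult B_M g y z by blast
    moreover have "g dvd y + z" using g by simp
    ultimately show ?thesis using B_dvd by blast
  qed (use z in simp)
  have "B x"
  proof (rule ccontr)
    assume "\<not> B x"
    have "\<not> B 0"
    proof
      assume "B 0"
      then show False using B_dvd[of 0 x] \<open>\<not> B x\<close> by simp
    qed
    then have "dsub.subspace Q"
    proof (intro subspaceI_mult)
      assume "\<not> B 0"
      then show "0 \<in> Q" using Q[of 0] by simp
      fix u assume "u \<in> Q"
      then obtain y where y: "u = to_fract y" "\<not> B y" unfolding Q_def by blast
      show "u + v \<in> Q" if v: "v \<in> Q" for v
      proof -
        obtain z where z: "v = to_fract z" "\<not> B z" using v unfolding Q_def by blast
        show ?thesis using Q[of "y + z"] B_add[OF y(2) z(2)] y(1) z(1) by simp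
      qed
      have "\<not> B (r * y)" for r using B_dvd[of "r * y" y] y(2) by auto
      then show "to_fract r * u \<in> Q" for r using Q[of "r * y"] y(1) by simp
    qed
    moreover have "1 \<notin> Q" using Q[of 1] B_M[OF one(1)] by simp
    moreover have "Q \<subseteq> base_ring" unfolding Q_def by auto
    moreover have "u \<in> Q \<or> v \<in> Q" if "u \<in> base_ring" "v \<in> base_ring" "u * v \<in> Q" for u v
      using that B_mult Q by (metis base_ringE to_fract_mult)
    ultimately have "prime_ideal Q" unfolding prime_ideal_def using proper_subspace by blast
    moreover have "Q \<subseteq> M" "Q \<subseteq> N" unfolding Q_def using B_M B_N by blast+
    moreover have "Q \<noteq> {0}" using Q[of x] \<open>\<not> B x\<close> x by auto
    ultimately show False using W M N \<open>M \<noteq> N\<close> unfolding weakly_matlis_def by blast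
  qed
  then show thesis using that unfolding B_def by blast
qed

text \<open>If \<open>a\<close> lies in \<open>M \<noteq> N\<close>, then \<open>a\<close> divides some \<open>st\<close> with \<open>s \<notin> M\<close> and \<open>t \<notin> N\<close>, so \<open>a = bc\<close> with
  \<open>b\<close> dividing \<open>s\<close> and \<open>c\<close> dividing \<open>t\<close>. Each factor avoids one of \<open>M\<close> and \<open>N\<close> and lies in the other, so
  the number of maximal \<open>t\<close>-ideals containing it drops.\<close>

lemma weakly_matlis_gcd_imp_hofd:
  assumes G: "gcd_domain TYPE('a::idom)" and W: "weakly_matlis TYPE('a)"
  shows "hofd TYPE('a)"
proof -
  define X where "X a = {M. maximal_t_ideal M \<and> to_fract a \<in> M}" for a :: 'a
  have "\<exists>xs. (\<forall>x\<in>set xs. homogeneous x) \<and> a = prod_list xs" if "nz_nonunit a" for a :: 'a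
    using that
  proof (induction "card (X a)" arbitrary: a rule: less_induct)
    case less
    have a0: "a \<noteq> 0" using less.prems by (simp add: nz_nonunit_def)
    have fin: "finite (X a)"
      using W less.prems unfolding X_def weakly_matlis_def finite_t_character_def by blast
    show ?case
    proof (cases "\<exists>M N. M \<in> X a \<and> N \<in> X a \<and> M \<noteq> N")
      case True
      then obtain M N where M: "M \<in> X a" and N: "N \<in> X a" and "M \<noteq> N" by blast
      then have max: "maximal_t_ideal M" "maximal_t_ideal N" by (simp_all add: X_def)
      note pM = maximal_t_ideal_prime[OF max(1)] and pN = maximal_t_ideal_prime[OF max(2)]
      obtain s t where st: "to_fract s \<notin> M" "to_fract t \<notin> N" "a dvd s * t"
        using weakly_matlis_gcd_separation[OF G W max \<open>M \<noteq> N\<close> a0] .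
      obtain b c where bc: "a = b * c" "b dvd s" "c dvd t"
        using gcd_domain_primal[OF G a0 st(3)] .
      have b: "to_fract b \<notin> M" and c: "to_fract c \<notin> N"
        using st bc prime_ideal_dvd[OF pM] prime_ideal_dvd[OF pN] by blast+
      have "to_fract (b * c) \<in> M" "to_fract (b * c) \<in> N" using M N bc(1) by (simp_all add: X_def)
      then have c': "to_fract c \<in> M" and b': "to_fract b \<in> N"
        using b c prime_ideal_mult_iff[OF pM] prime_ideal_mult_iff[OF pN] by blast+
      have nz: "nz_nonunit b" "nz_nonunit c"
        using prime_ideal_elem[OF pN b'] prime_ideal_elem[OF pM c'] a0 bc(1) by auto
      have "X b \<subseteq> X a" "X c \<subseteq> X a"
        unfolding X_def bc(1) using prime_ideal_mult_iff maximal_t_ideal_prime by blast+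
      then have "X b \<subset> X a" "X c \<subset> X a" using M N b c unfolding X_def by blast+
      then have "card (X b) < card (X a)" "card (X c) < card (X a)"
        using fin psubset_card_mono by blast+
      then obtain xs ys where "\<forall>x\<in>set xs. homogeneous x" "b = prod_list xs"
        "\<forall>x\<in>set ys. homogeneous x" "c = prod_list ys"
        using less.hyps nz by metis
      then have "(\<forall>x\<in>set (xs @ ys). homogeneous x) \<and> a = prod_list (xs @ ys)"
        using bc(1) by auto
      then show ?thesis ..
    next
      case False
      obtain M where "M \<in> X a"
        using nonunit_in_maximal_t_ideal[OF less.prems] by (auto simp: X_def)
      then have "\<exists>!M. M \<in> X a" using False by blast
      then have "homogeneous a" using less.prems by (simp add: homogeneous_def X_def)
      then have "(\<forall>x\<in>set [a]. homogeneous x) \<and> a = prod_list [a]" by simp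
      then show ?thesis ..
    qed
  qed
  then show ?thesis by (simp add: hofd_def)
qed

section \<open>Finitely generated ideals and the \<open>t\<close>-class group\<close>

lemma in_principal_iff:
  assumes "g \<noteq> 0"
  shows "x \<in> principal g \<longleftrightarrow> x / g \<in> base_ring"
proof -
  have "x \<in> principal g \<longleftrightarrow> (\<exists>r. x = to_fract r * g)"
    by (auto simp: principal_def dsub.span_singleton fract_scale_def)
  also have "\<dots> \<longleftrightarrow> (\<exists>r. x / g = to_fract r)" using assms by (simp add: field_simps)
  finally show ?thesis by (auto simp: base_ring_def)
qed

lemma v_closure_principal:
  assumes "g \<noteq> 0" and "\<And>w. (\<forall>s\<in>S. w * s \<in> base_ring) \<longleftrightarrow> w * g \<in> base_ring"
  shows "v_closure (dsub.span S) = principal g"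
proof -
  have "x \<in> v_closure (dsub.span S) \<longleftrightarrow> x / g \<in> base_ring" for x
  proof
    assume "x \<in> v_closure (dsub.span S)"
    then have "1 / g * g \<in> base_ring \<longrightarrow> 1 / g * x \<in> base_ring"
      using assms(2) unfolding v_closure_span_iff by blast
    then show "x / g \<in> base_ring" using assms(1) by simp
  next
    assume x: "x / g \<in> base_ring"
    have "w * x \<in> base_ring" if "w * g \<in> base_ring" for w
      using base_ring_mult[OF that x] assms(1) by simp
    then show "x \<in> v_closure (dsub.span S)" using assms(2) by (simp add: v_closure_span_iff)
  qed
  then show ?thesis using in_principal_iff[OF assms(1)] by blast
qed

lemma t_ideal_principal: "g \<noteq> 0 \<Longrightarrow> t_ideal (principal g)"
  using v_closure_principal[of g "{g}"] t_ideal_v_closure[of "{g}"] by simp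

lemma gcd_domain_fractional_gcd:
  assumes G: "gcd_domain TYPE('a::idom)" and S: "finite S" "\<not> S \<subseteq> {0 :: 'a fract}"
  obtains g where "g \<noteq> 0" "\<And>w. (\<forall>s\<in>S. w * s \<in> base_ring) \<longleftrightarrow> w * g \<in> base_ring"
proof -
  obtain d where d: "d \<noteq> 0" "\<forall>s\<in>S. to_fract d * s \<in> base_ring"
    using common_denominator[OF S(1)] by blast
  then have "\<forall>s\<in>S. \<exists>r. s = to_fract r / to_fract d"
    by (metis base_ringE nonzero_mult_div_cancel_left to_fract_eq_0_iff)
  then obtain f where f: "\<And>s. s \<in> S \<Longrightarrow> s = to_fract (f s) / to_fract d" by metis
  obtain h where h: "gcd_of h (f ` S)" using gcd_of_finite_exists[OF G] S(1) by blast
  obtain s where "s \<in> S" "s \<noteq> 0" using S(2) by blast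
  then have "f s \<noteq> 0" "h dvd f s" using f[of s] gcd_of_dvd[OF h] by auto
  then have h0: "h \<noteq> 0" by auto
  have "(\<forall>s\<in>S. w * s \<in> base_ring) \<longleftrightarrow> w * (to_fract h / to_fract d) \<in> base_ring" for w
  proof -
    obtain p q where q: "q \<noteq> 0" "w = to_fract p / to_fract q" by (rule fraction_cases)
    have iff: "w * (to_fract r / to_fract d) \<in> base_ring \<longleftrightarrow> q * d dvd p * r" for r
      using quotient_in_base_ring_iff[of "q * d" "p * r"] q d(1) by simp
    have "(\<forall>s\<in>S. w * s \<in> base_ring) \<longleftrightarrow> (\<forall>s\<in>S. q * d dvd p * f s)"
      using f iff by metis
    also have "\<dots> \<longleftrightarrow> q * d dvd p * h"
      using gcd_of_scale[OF G _ h, of p] S(1) by (auto simp: gcd_of_def)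
    also have "\<dots> \<longleftrightarrow> w * (to_fract h / to_fract d) \<in> base_ring" using iff by simp
    finally show ?thesis .
  qed
  moreover have "to_fract h / to_fract d \<noteq> 0" using h0 d(1) by simp
  ultimately show thesis using that by blast
qed

lemma t_closure_eq_base_ring_iff:
  assumes A: "dsub.subspace A" "A \<subseteq> base_ring"
  shows "t_closure A = base_ring
    \<longleftrightarrow> (\<exists>S. finite S \<and> S \<subseteq> A \<and> \<not> S \<subseteq> {0} \<and> 1 \<in> v_closure (dsub.span S))"
    (is "_ \<longleftrightarrow> ?R")
proof
  assume "t_closure A = base_ring"
  then have "1 \<in> t_closure A" by simp
  then show ?R unfolding t_closure_alt[OF A(1)] by blast
next
  assume ?R
  then obtain S where S: "finite S" "S \<subseteq> A" "\<not> S \<subseteq> {0}" "1 \<in> v_closure (dsub.span S)" by blast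
  have "v_closure (dsub.span T) \<subseteq> base_ring" if "T \<subseteq> A" for T
    using that A(2) dsub.span_minimal[OF _ subspace_base_ring, of T] v_closure_in_base_ring by blast
  then have "t_closure A \<subseteq> base_ring" unfolding t_closure_alt[OF A(1)] by blast
  moreover have "base_ring \<subseteq> v_closure (dsub.span S)"
    using subspace_mult[OF subspace_v_closure S(4)] by auto
  then have "base_ring \<subseteq> t_closure A" unfolding t_closure_alt[OF A(1)] using S(1-3) by blast
  ultimately show "t_closure A = base_ring" by blast
qed

lemma ideal_prod_inv_integral: "ideal_prod A (ideal_inv A) \<subseteq> base_ring"
  unfolding ideal_prod_def
  by (intro dsub.span_minimal subspace_base_ring) (auto simp: ideal_inv_def mult.commute)

lemma subspace_ideal_prod: "dsub.subspace (ideal_prod A B)"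
  by (simp add: ideal_prod_def)

lemma mult_in_ideal_prod: "a \<in> A \<Longrightarrow> b \<in> B \<Longrightarrow> a * b \<in> ideal_prod A B"
  unfolding ideal_prod_def by (intro dsub.span_base) blast

lemma ideal_prod_mono: "A \<subseteq> A' \<Longrightarrow> B \<subseteq> B' \<Longrightarrow> ideal_prod A B \<subseteq> ideal_prod A' B'"
  unfolding ideal_prod_def by (intro dsub.span_mono) blast

lemma t_invertible_iff:
  "t_invertible A \<longleftrightarrow> nz_fractional_ideal A
    \<and> (\<exists>S. finite S \<and> S \<subseteq> ideal_prod A (ideal_inv A) \<and> \<not> S \<subseteq> {0} \<and> 1 \<in> v_closure (dsub.span S))"
  unfolding t_invertible_def
  by (simp add: t_closure_eq_base_ring_iff subspace_ideal_prod ideal_prod_inv_integral)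

lemma gcd_domain_imp_pvmd:
  assumes G: "gcd_domain TYPE('a::idom)"
  shows "pvmd TYPE('a)"
  unfolding pvmd_def
proof (intro allI impI)
  fix I :: "'a fract set" assume I: "fin_gen I \<and> I \<subseteq> base_ring \<and> I \<noteq> {0}"
  then obtain S where S: "finite S" "I = dsub.span S" unfolding fin_gen_def by blast
  then have S0: "\<not> S \<subseteq> {0}" using I span_eq_zero_iff by blast
  obtain g where g: "g \<noteq> 0" "\<And>w. (\<forall>s\<in>S. w * s \<in> base_ring) \<longleftrightarrow> w * g \<in> base_ring"
    using gcd_domain_fractional_gcd[OF G S(1) S0] by metis
  let ?T = "(\<lambda>s. s * (1 / g)) ` S"
  have "\<forall>s\<in>S. 1 / g * s \<in> base_ring" unfolding g(2) using g(1) by simp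
  then have "\<forall>s\<in>I. 1 / g * s \<in> base_ring"
    unfolding S(2) using mult_span_in[OF subspace_base_ring] by blast
  then have "1 / g \<in> ideal_inv I" by (simp add: ideal_inv_def)
  then have "?T \<subseteq> ideal_prod I (ideal_inv I)"
    unfolding S(2) by (auto intro!: mult_in_ideal_prod[where b = "1 / g", simplified] dsub.span_base)
  moreover have "1 \<in> v_closure (dsub.span ?T)"
    unfolding v_closure_span_iff
  proof (intro allI impI)
    fix w assume "\<forall>t\<in>?T. w * t \<in> base_ring"
    then have "\<forall>s\<in>S. (w / g) * s \<in> base_ring" by (auto simp: mult_ac)
    then show "w * 1 \<in> base_ring" unfolding g(2) using g(1) by simp
  qed
  moreover have "finite ?T" "\<not> ?T \<subseteq> {0}" using S S0 g(1) by auto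
  ultimately show "t_invertible I"
    using nz_fractional_span[OF S(1) S0] S(2) unfolding t_invertible_iff by blast
qed

lemma ideal_prod_finite_support:
  assumes "finite S" "S \<subseteq> ideal_prod A B"
  shows "\<exists>F. finite F \<and> F \<subseteq> A \<and> S \<subseteq> ideal_prod F B"
proof -
  let ?U = "{x. \<exists>F. finite F \<and> F \<subseteq> A \<and> x \<in> ideal_prod F B}"
  have "dsub.subspace ?U"
  proof (rule subspaceI_mult)
    show "0 \<in> ?U"
      using dsub.subspace_0[OF subspace_ideal_prod[of "{}" B]] by blast
    show "x + y \<in> ?U" if xy: "x \<in> ?U" "y \<in> ?U" for x y
    proof -
      obtain F F' where F: "finite F" "F \<subseteq> A" "x \<in> ideal_prod F B"
        and F': "finite F'" "F' \<subseteq> A" "y \<in> ideal_prod F' B" using xy by blast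
      have "x \<in> ideal_prod (F \<union> F') B" "y \<in> ideal_prod (F \<union> F') B"
        using F(3) F'(3) ideal_prod_mono[of F "F \<union> F'" B B] ideal_prod_mono[of F' "F \<union> F'" B B]
        by auto
      then have "x + y \<in> ideal_prod (F \<union> F') B"
        by (rule dsub.subspace_add[OF subspace_ideal_prod])
      then show ?thesis using F F' by (intro CollectI exI[of _ "F \<union> F'"]) auto
    qed
    show "to_fract r * x \<in> ?U" if x: "x \<in> ?U" for r x
      using x subspace_mult[OF subspace_ideal_prod _ to_fract_in_base_ring] by blast
  qed
  moreover have "{a * b | a b. a \<in> A \<and> b \<in> B} \<subseteq> ?U"
  proof
    fix x assume "x \<in> {a * b | a b. a \<in> A \<and> b \<in> B}"
    then obtain a b where "x = a * b" "a \<in> A" "b \<in> B" by blast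
    then have "finite {a} \<and> {a} \<subseteq> A \<and> x \<in> ideal_prod {a} B" by (simp add: mult_in_ideal_prod)
    then show "x \<in> ?U" by blast
  qed
  ultimately have U: "ideal_prod A B \<subseteq> ?U"
    unfolding ideal_prod_def[of A B] by (rule dsub.span_minimal[rotated])
  show ?thesis
    using assms
  proof (induction S)
    case (insert x S)
    from insert.IH insert.prems obtain F where F: "finite F" "F \<subseteq> A" "S \<subseteq> ideal_prod F B" by blast
    obtain F' where F': "finite F'" "F' \<subseteq> A" "x \<in> ideal_prod F' B"
      using subsetD[OF U, of x] insert.prems by auto
    have "insert x S \<subseteq> ideal_prod (F \<union> F') B"
      using F(3) F'(3) ideal_prod_mono[of F "F \<union> F'" B B] ideal_prod_mono[of F' "F \<union> F'" B B]
      by auto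
    then show ?case using F F' by (intro exI[of _ "F \<union> F'"]) auto
  qed auto
qed

text \<open>If \<open>1 \<in> S\<^sub>v\<close> for a finite set \<open>S\<close> in \<open>AA\<^sup>-\<^sup>1\<close>, then the elements of \<open>S\<close> involve only a finite subset
  \<open>F\<close> of \<open>A\<close>. For \<open>x \<in> A\<close> and \<open>wF \<subseteq> D\<close> we get \<open>(wx)(ab) = (wa)(xb) \<in> D\<close> for all \<open>a \<in> F\<close> and
  \<open>b \<in> A\<^sup>-\<^sup>1\<close>, so \<open>wxS \<subseteq> D\<close> and \<open>wx \<in> D\<close>. Hence \<open>A\<close> is contained in \<open>F\<^sub>v\<close>.\<close>

lemma t_invertible_t_ideal_finite_type:
  assumes t: "t_ideal A" and inv: "t_invertible A"
  obtains F where "finite F" "\<not> F \<subseteq> {0}" "A = v_closure (dsub.span F)"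
proof -
  obtain S where S: "finite S" "S \<subseteq> ideal_prod A (ideal_inv A)" "1 \<in> v_closure (dsub.span S)"
      "\<not> S \<subseteq> {0}"
    using inv unfolding t_invertible_iff by blast
  obtain F where F: "finite F" "F \<subseteq> A" "S \<subseteq> ideal_prod F (ideal_inv A)"
    using ideal_prod_finite_support[OF S(1,2)] by blast
  have A: "A \<subseteq> v_closure (dsub.span F)"
  proof
    fix x assume x: "x \<in> A"
    show "x \<in> v_closure (dsub.span F)"
      unfolding v_closure_span_iff
    proof (intro allI impI)
      fix w assume w: "\<forall>a\<in>F. w * a \<in> base_ring"
      have "w * x * s \<in> base_ring" if "s \<in> S" for s
      proof (rule mult_span_in[OF subspace_base_ring])
        show "s \<in> dsub.span {a * b | a b. a \<in> F \<and> b \<in> ideal_inv A}"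
          using F(3) that by (auto simp: ideal_prod_def)
        fix r assume "r \<in> {a * b | a b. a \<in> F \<and> b \<in> ideal_inv A}"
        then obtain a b where r: "r = a * b" "a \<in> F" "b \<in> ideal_inv A" by blast
        then have "(w * a) * (b * x) \<in> base_ring"
          using w x base_ring_mult[of "w * a" "b * x"] by (auto simp: ideal_inv_def)
        then show "w * x * r \<in> base_ring" using r(1) by (simp add: mult_ac)
      qed
      then have "w * x * 1 \<in> base_ring" using S(3) unfolding v_closure_span_iff by blast
      then show "w * x \<in> base_ring" by simp
    qed
  qed
  have F0: "\<not> F \<subseteq> {0}"
  proof
    assume "F \<subseteq> {0}"
    then have "ideal_prod F (ideal_inv A) \<subseteq> {0}"
      unfolding ideal_prod_def by (intro dsub.span_minimal) auto
    then have "S \<subseteq> {0}" using F(3) by blast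
    then show False using S(4) by blast
  qed
  have "v_closure (dsub.span F) \<subseteq> A" using t F F0 unfolding t_ideal_iff by blast
  then show thesis using that F(1) F0 A by blast
qed

lemma base_ring_eq_principal: "base_ring = principal 1"
  using in_principal_iff[of 1] by auto

lemma ideal_prod_principal:
  assumes "dsub.subspace A"
  shows "ideal_prod (principal y) A = (*) y ` A"
proof
  have "dsub.subspace ((*) y ` A)"
  proof (rule subspaceI_mult)
    show "0 \<in> (*) y ` A" using dsub.subspace_0[OF assms] by (metis image_eqI mult_zero_right)
    show "u + v \<in> (*) y ` A" if "u \<in> (*) y ` A" "v \<in> (*) y ` A" for u v
      using that dsub.subspace_add[OF assms] by (auto simp: distrib_left[symmetric])
    show "to_fract r * u \<in> (*) y ` A" if "u \<in> (*) y ` A" for r u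
      using that subspace_mult[OF assms _ to_fract_in_base_ring[of r]]
      by (auto simp: mult.left_commute)
  qed
  moreover have "a * b \<in> (*) y ` A" if ab: "a \<in> principal y" "b \<in> A" for a b
  proof -
    obtain r where "a = to_fract r * y"
      using ab(1) by (auto simp: principal_def dsub.span_singleton fract_scale_def)
    then have "a * b = y * (to_fract r * b)" by (simp add: mult_ac)
    then show ?thesis using subspace_mult[OF assms ab(2) to_fract_in_base_ring[of r]] by blast
  qed
  ultimately show "ideal_prod (principal y) A \<subseteq> (*) y ` A"
    unfolding ideal_prod_def by (intro dsub.span_minimal) auto
  have "y \<in> principal y" by (simp add: principal_def dsub.span_base)
  then show "(*) y ` A \<subseteq> ideal_prod (principal y) A" using mult_in_ideal_prod by blast
qed

lemma principal_mult: "ideal_prod (principal y) (principal x) = principal (y * x)"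
proof -
  have "ideal_prod (principal y) (principal x) = (*) y ` principal x"
    by (rule ideal_prod_principal) (simp add: principal_def)
  also have "\<dots> = principal (y * x)"
    by (auto simp: principal_def dsub.span_singleton fract_scale_def image_image mult.left_commute)
  finally show ?thesis .
qed

text \<open>The coset of \<open>A\<close> consists of the ideals \<open>yA\<close> with \<open>y \<noteq> 0\<close>. It contains \<open>A\<close>, so it can only be the
  subgroup of principal ideals if \<open>A\<close> is principal itself.\<close>

lemma trivial_t_class_group_iff:
  "trivial_t_class_group TYPE('a::idom) \<longleftrightarrow>
    (\<forall>A :: 'a fract set. t_ideal A \<and> t_invertible A \<longrightarrow> (\<exists>x. x \<noteq> 0 \<and> A = principal x))"
proof -
  let ?coset = "\<lambda>A :: 'a fract set. {t_closure (ideal_prod (principal y) A) | y. y \<noteq> 0}"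
  let ?C = "{A :: 'a fract set. t_ideal A \<and> t_invertible A}"
  let ?H = "{principal x | x :: 'a fract. x \<noteq> 0}"
  have coset: "principal_ideals #>\<^bsub>t_invertible_group\<^esub> A = ?coset A" for A :: "'a fract set"
    by (auto simp: r_coset_def t_invertible_group_def principal_ideals_def)
  have "trivial_t_class_group TYPE('a) \<longleftrightarrow> ?coset ` ?C = {?H}"
    unfolding trivial_t_class_group_def t_class_group_def FactGroup_def RCOSETS_def coset
    by (simp add: t_invertible_group_def principal_ideals_def UNION_singleton_eq_range)
  also have "\<dots> \<longleftrightarrow> (\<forall>A\<in>?C. \<exists>x. x \<noteq> 0 \<and> A = principal x)"
  proof
    assume eq: "?coset ` ?C = {?H}"
    show "\<forall>A\<in>?C. \<exists>x. x \<noteq> 0 \<and> A = principal x"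
    proof
      fix A :: "'a fract set" assume A: "A \<in> ?C"
      have "ideal_prod (principal 1) A = A"
        using ideal_prod_principal[OF t_ideal_subspace, of A 1] A by (simp add: image_def)
      then have "t_closure (ideal_prod (principal 1) A) = A" using A by (simp add: t_ideal_def)
      then have "A \<in> ?coset A" by (intro CollectI exI[of _ 1]) simp
      moreover have "?coset A \<in> ?coset ` ?C" using A by (rule imageI)
      then have "?coset A = ?H" unfolding eq by (rule singletonD)
      ultimately have "A \<in> ?H" by simp
      then show "\<exists>x. x \<noteq> 0 \<and> A = principal x" by blast
    qed
  next
    assume all: "\<forall>A\<in>?C. \<exists>x. x \<noteq> 0 \<and> A = principal x"
    have t: "t_ideal (base_ring :: 'a fract set)"
      unfolding base_ring_eq_principal by (rule t_ideal_principal) simp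
    have "1 \<in> ideal_inv (base_ring :: 'a fract set)" by (simp add: ideal_inv_def)
    then have "1 * 1 \<in> ideal_prod base_ring (ideal_inv (base_ring :: 'a fract set))"
      by (intro mult_in_ideal_prod) simp_all
    moreover have "1 \<in> v_closure (dsub.span {1 :: 'a fract})"
      using subset_v_closure dsub.span_base by blast
    ultimately have "t_invertible (base_ring :: 'a fract set)"
      using t unfolding t_invertible_iff t_ideal_def
      by (intro conjI exI[of _ "{1}"]) auto
    then have ne: "base_ring \<in> ?C" using t by blast
    have const: "?coset A = ?H" if A: "A \<in> ?C" for A
    proof -
      obtain x where x: "x \<noteq> 0" "A = principal x" using all A by blast
      have "t_closure (ideal_prod (principal y) A) = principal (y * x)" if "y \<noteq> 0" for y
        unfolding x(2) principal_mult using t_ideal_principal[of "y * x"] that x(1)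
        by (simp add: t_ideal_def)
      then have "?coset A = {principal (y * x) | y. y \<noteq> 0}" by force
      also have "\<dots> = ?H"
      proof
        show "?H \<subseteq> {principal (y * x) | y. y \<noteq> 0}"
        proof
          fix B assume "B \<in> ?H"
          then obtain z where "z \<noteq> 0" "B = principal (z / x * x)" using x(1) by auto
          then show "B \<in> {principal (y * x) | y. y \<noteq> 0}"
            using x(1) by (metis (mono_tags, lifting) divide_eq_0_iff mem_Collect_eq)
        qed
      qed (use x(1) in auto)
      finally show ?thesis .
    qed
    have "?coset ` ?C = (\<lambda>_. ?H) ` ?C" by (rule image_cong[OF refl const])
    also have "\<dots> = {?H}" unfolding image_constant_conv using ne by (metis empty_iff)
    finally show "?coset ` ?C = {?H}" .
  qed
  finally show ?thesis by blast
qed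

lemma gcd_domain_imp_trivial_t_class_group:
  assumes G: "gcd_domain TYPE('a::idom)"
  shows "trivial_t_class_group TYPE('a)"
  unfolding trivial_t_class_group_iff
proof (intro allI impI)
  fix A :: "'a fract set" assume "t_ideal A \<and> t_invertible A"
  then obtain F where F: "finite F" "\<not> F \<subseteq> {0}" "A = v_closure (dsub.span F)"
    using t_invertible_t_ideal_finite_type by blast
  obtain g where "g \<noteq> 0" "\<And>w. (\<forall>s\<in>F. w * s \<in> base_ring) \<longleftrightarrow> w * g \<in> base_ring"
    using gcd_domain_fractional_gcd[OF G F(1,2)] by metis
  then show "\<exists>x. x \<noteq> 0 \<and> A = principal x" using v_closure_principal F(3) by blast
qed

text \<open>A generator of \<open>(a, b)\<^sub>v\<close>, which is a \<open>t\<close>-invertible \<open>t\<close>-ideal, is a greatest common divisor.\<close>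

lemma pvmd_trivial_t_class_group_imp_gcd_domain:
  assumes P: "pvmd TYPE('a::idom)" and C: "trivial_t_class_group TYPE('a)"
  shows "gcd_domain TYPE('a)"
proof -
  have "\<exists>g. gcd_of g {a, b}" for a b :: 'a
  proof (cases "a = 0 \<and> b = 0")
    case True
    then have "gcd_of 0 {a, b}" unfolding gcd_of_pair by simp
    then show ?thesis ..
  next
    case False
    let ?S = "{to_fract a, to_fract b}"
    let ?I = "dsub.span ?S"
    let ?A = "v_closure ?I"
    have S: "finite ?S" "\<not> ?S \<subseteq> {0}" using False by auto
    have int: "?I \<subseteq> base_ring" by (intro dsub.span_minimal subspace_base_ring) auto
    have "fin_gen ?I" unfolding fin_gen_def by (intro exI[of _ ?S]) simp
    moreover have "?I \<noteq> {0}" using S span_eq_zero_iff by blast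
    ultimately have "t_invertible ?I" using P int unfolding pvmd_def by blast
    moreover have "ideal_prod ?I (ideal_inv ?I) \<subseteq> ideal_prod ?A (ideal_inv ?A)"
      using subset_v_closure by (intro ideal_prod_mono) (auto simp: ideal_inv_v_closure)
    ultimately have "t_invertible ?A"
      using nz_fractional_v_closure unfolding t_invertible_iff by (meson subset_trans)
    then obtain x where x: "x \<noteq> 0" "?A = principal x"
      using C t_ideal_v_closure[OF S] unfolding trivial_t_class_group_iff by blast
    have xA: "x \<in> ?A" unfolding x(2) by (simp add: principal_def dsub.span_base)
    then obtain g where g: "x = to_fract g" using v_closure_in_base_ring[OF int] base_ringE by blast
    then have g0: "g \<noteq> 0" using x(1) by auto
    have "?S \<subseteq> ?A" using subset_v_closure dsub.span_superset by blast
    then have "g dvd a" "g dvd b"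
      using in_principal_iff[OF x(1)] x(2) quotient_in_base_ring_iff[OF g0] unfolding g by auto
    moreover have "c dvd g" if c: "c dvd a" "c dvd b" for c
    proof -
      have c0: "c \<noteq> 0" using c False by auto
      have "\<forall>s\<in>?S. 1 / to_fract c * s \<in> base_ring"
        using c quotient_in_base_ring_iff[OF c0] by simp
      then have "1 / to_fract c * x \<in> base_ring" using xA unfolding v_closure_span_iff by blast
      then show ?thesis using quotient_in_base_ring_iff[OF c0] g by simp
    qed
    ultimately have "gcd_of g {a, b}" by (simp add: gcd_of_pair)
    then show ?thesis ..
  qed
  then show ?thesis by (simp add: gcd_domain_iff)
qed

section \<open>Valuation factorizations in polynomial rings\<close>

text \<open>A valuation overring of \<open>D[X]\<close> contracts to one of \<open>D\<close>. The contraction is described by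
  representing fractions, so that no embedding of quotient fields has to be constructed.\<close>

lemma valuation_element_const:
  assumes "valuation_element [:b:]"
  shows "valuation_element (b::'a::idom)"
proof -
  obtain W where W: "valuation_overring W" "value_saturated W [:b:]" and nz: "nz_nonunit [:b:]"
    using assms by (auto simp: valuation_element_iff)
  have "nz_nonunit b" using nz by (simp only: nz_nonunit_const)
  then have b: "b \<noteq> 0" "nz_nonunit b" by (simp_all add: nz_nonunit_def)
  have over: "overring W" using W by (simp add: valuation_overring_def)
  define V where "V = {to_fract p / to_fract q | p q. q \<noteq> 0 \<and> to_fract [:p:] / to_fract [:q:] \<in> W}"
  have VI: "to_fract p / to_fract q \<in> V" if "q \<noteq> 0" "to_fract [:p:] / to_fract [:q:] \<in> W" for p q
    unfolding V_def using that by (intro CollectI exI[of _ p] exI[of _ q]) simp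
  have "overring V"
    unfolding overring_def
  proof (intro conjI ballI subsetI)
    fix u :: "'a fract" assume "u \<in> base_ring"
    then obtain x where x: "u = to_fract x" by (rule base_ringE)
    have "to_fract [:x:] / to_fract [:1:] \<in> W"
      using overring_closed(1)[OF over] by (auto simp: one_pCons[symmetric])
    then show "u \<in> V" using VI[of 1 x] x by simp
  next
    fix u v assume "u \<in> V" "v \<in> V"
    then obtain x s y t where
      u: "u = to_fract x / to_fract s" "s \<noteq> 0" "to_fract [:x:] / to_fract [:s:] \<in> W"
      and v: "v = to_fract y / to_fract t" "t \<noteq> 0" "to_fract [:y:] / to_fract [:t:] \<in> W"
      unfolding V_def by blast
    have st: "s * t \<noteq> 0" using u v by simp
    have "[:x * t - y * s:] = [:x:] * [:t:] - [:y:] * [:s:]" "[:s * t:] = [:s:] * [:t:]"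
      by (simp_all add: mult.commute)
    then have "to_fract [:x * t - y * s:] / to_fract [:s * t:]
        = to_fract [:x:] / to_fract [:s:] - to_fract [:y:] / to_fract [:t:]"
      using u(2) v(2) by (simp only: to_fract_diff to_fract_mult) (simp add: field_simps)
    also have "\<dots> \<in> W" using over u(3) v(3) by (simp add: overring_def)
    finally have "to_fract (x * t - y * s) / to_fract (s * t) \<in> V" by (rule VI[OF st])
    moreover have "u - v = to_fract (x * t - y * s) / to_fract (s * t)"
      unfolding u(1) v(1) using u(2) v(2) by (simp add: diff_frac_eq)
    ultimately show "u - v \<in> V" by simp
    have "[:x * y:] = [:x:] * [:y:]" "[:s * t:] = [:s:] * [:t:]" by (simp_all add: mult.commute)
    then have "to_fract [:x * y:] / to_fract [:s * t:]
        = (to_fract [:x:] / to_fract [:s:]) * (to_fract [:y:] / to_fract [:t:])"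
      by (simp only: to_fract_mult) simp
    also have "\<dots> \<in> W" using u(3) v(3) by (rule overring_closed(3)[OF over])
    finally have "to_fract (x * y) / to_fract (s * t) \<in> V" by (rule VI[OF st])
    then show "u * v \<in> V" using u v by simp
  qed
  moreover have "w \<in> V \<or> inverse w \<in> V" if w: "w \<noteq> 0" for w
  proof -
    obtain p q where pq: "q \<noteq> 0" "w = to_fract p / to_fract q" by (rule fraction_cases)
    then have p0: "p \<noteq> 0" using w by auto
    have "to_fract [:p:] / to_fract [:q:] \<noteq> 0" using pq p0 by simp
    then have "to_fract [:p:] / to_fract [:q:] \<in> W \<or> to_fract [:q:] / to_fract [:p:] \<in> W"
      using W(1) unfolding valuation_overring_def by (metis inverse_divide)
    then show ?thesis using VI[OF pq(1)] VI[OF p0] pq(2) by auto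
  qed
  ultimately have "valuation_overring V" by (simp add: valuation_overring_def)
  moreover have "value_saturated V b"
    unfolding value_saturated_def
  proof (intro allI impI)
    fix x assume "to_fract x / to_fract b \<in> V"
    then obtain p q where q: "to_fract x / to_fract b = to_fract p / to_fract q" "q \<noteq> 0"
      "to_fract [:p:] / to_fract [:q:] \<in> W" unfolding V_def by blast
    then have "to_fract (x * q) = to_fract (p * b)" using b(1) by (simp add: field_simps)
    then have "x * q = p * b" by (simp only: to_fract_eq_iff)
    then have "[:x:] * [:q:] = [:p:] * [:b:]" by (simp add: mult.commute)
    then have "to_fract [:x:] * to_fract [:q:] = to_fract [:p:] * to_fract [:b:]"
      by (simp only: to_fract_mult[symmetric])
    then have "to_fract [:x:] / to_fract [:b:] = to_fract [:p:] / to_fract [:q:]"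
      using b(1) q(2) by (simp add: field_simps)
    then have "[:b:] dvd [:x:]" using q(3) W(2) unfolding value_saturated_def by metis
    then show "b dvd x" by (simp only: const_dvd_const_iff)
  qed
  ultimately show ?thesis using b(2) valuation_element_iff by blast
qed

lemma vfd_poly_imp_vfd:
  assumes "vfd TYPE('a::idom poly)"
  shows "vfd TYPE('a)"
  unfolding vfd_def
proof (intro allI impI)
  fix a :: 'a assume a: "nz_nonunit a"
  then have "nz_nonunit [:a:]" by (simp only: nz_nonunit_const)
  then obtain xs where xs: "\<forall>x\<in>set xs. valuation_element x" "[:a:] = prod_list xs"
    using assms unfolding vfd_def by blast
  define bs where "bs = map (\<lambda>x. coeff x 0) xs"
  have const: "x = [:coeff x 0:]" if x: "x \<in> set xs" for x
  proof -
    obtain us vs where "xs = us @ x # vs" using split_list[OF x] by blast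
    then have "x dvd [:a:]" using xs(2) by simp
    then obtain b where "x = [:b:]" using divisor_of_const a by (metis nz_nonunit_def)
    then show ?thesis by simp
  qed
  have "xs = map (\<lambda>b. [:b:]) bs" unfolding bs_def using const by (simp add: map_idI)
  then have "[:a:] = [:prod_list bs:]" using xs(2) const_prod_list by metis
  then have "a = prod_list bs" by simp
  moreover have "valuation_element b" if b: "b \<in> set bs" for b
  proof -
    obtain x where x: "x \<in> set xs" "b = coeff x 0" using b by (auto simp: bs_def)
    then have "valuation_element [:b:]" using xs(1) const by metis
    then show ?thesis by (rule valuation_element_const)
  qed
  ultimately show "\<exists>xs. (\<forall>x\<in>set xs. valuation_element x) \<and> a = prod_list xs" by blast
qed

lemma gcd_vfd_imp_vfd_poly:
  assumes G: "gcd_domain TYPE('a::idom)" and F: "vfd TYPE('a)"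
  shows "vfd TYPE('a poly)"
  unfolding vfd_def
proof (intro allI impI)
  fix f :: "'a poly" assume "nz_nonunit f"
  moreover have "\<exists>xs. (\<forall>x\<in>set xs. rigid x) \<and> a = prod_list xs" if "nz_nonunit a" for a :: 'a
    using F that valuation_element_rigid unfolding vfd_def by blast
  ultimately have "\<exists>xs. (\<forall>x\<in>set xs. rigid x) \<and> f = prod_list xs"
    using poly_product_of_rigid[OF G] by blast
  then show "\<exists>xs. (\<forall>x\<in>set xs. valuation_element x) \<and> f = prod_list xs"
    using rigid_imp_valuation_element[OF gcd_domain_poly[OF G]] by blast
qed

section \<open>The equivalences\<close>

theorem theorem3p4:
  assumes "t_treed TYPE('a::idom)"
  shows "(vfd TYPE('a) \<longleftrightarrow> hofd TYPE('a) \<and> pvmd TYPE('a)) \<and>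
    (vfd TYPE('a) \<longleftrightarrow>
       independent_ring_of_Krull_type TYPE('a) \<and> trivial_t_class_group TYPE('a)) \<and>
    (vfd TYPE('a) \<longleftrightarrow> vfd TYPE('a poly)) \<and>
    (vfd TYPE('a) \<longleftrightarrow> weakly_matlis_gcd_domain TYPE('a))"
proof -
  have "gcd_domain TYPE('a) \<and> hofd TYPE('a)" if "vfd TYPE('a)"
    using that treed_vfd_imp_gcd_domain vfd_imp_hofd assms by blast
  moreover have "vfd TYPE('a)" if "gcd_domain TYPE('a) \<and> hofd TYPE('a)"
    using that gcd_hofd_imp_vfd by blast
  ultimately have vfd: "vfd TYPE('a) \<longleftrightarrow> gcd_domain TYPE('a) \<and> hofd TYPE('a)" by blast
  have matlis: "gcd_domain TYPE('a) \<Longrightarrow> hofd TYPE('a) \<longleftrightarrow> weakly_matlis TYPE('a)"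
    using hofd_imp_weakly_matlis weakly_matlis_gcd_imp_hofd by blast
  have "vfd TYPE('a) \<longleftrightarrow> hofd TYPE('a) \<and> pvmd TYPE('a)"
    using vfd gcd_domain_imp_pvmd hofd_pvmd_imp_gcd_domain by blast
  moreover have "vfd TYPE('a) \<longleftrightarrow>
      independent_ring_of_Krull_type TYPE('a) \<and> trivial_t_class_group TYPE('a)"
    unfolding independent_ring_of_Krull_type_def
    using vfd matlis gcd_domain_imp_pvmd gcd_domain_imp_trivial_t_class_group
      pvmd_trivial_t_class_group_imp_gcd_domain by blast
  moreover have "vfd TYPE('a) \<longleftrightarrow> vfd TYPE('a poly)"
    using vfd gcd_vfd_imp_vfd_poly vfd_poly_imp_vfd by blast
  moreover have "vfd TYPE('a) \<longleftrightarrow> weakly_matlis_gcd_domain TYPE('a)"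
    unfolding weakly_matlis_gcd_domain_def using vfd matlis by blast
  ultimately show ?thesis by blast
qed

end
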